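(* Let $0<p\le q<+\infty$, and let $w$ be a strictly positive measurable function on $(0,+\infty)$ such that $W(x)=\int_0^x w(s)\,\mathrm{d}s$ is finite for each $x>0$ and $W(+\infty)=+\infty$. Let $g$ be a non-negative real continuous and strictly monotone function on $(0,+\infty)$ such that $g^{-1}\in\Phi$. Let $u,v$ be weights on $(0,+\infty)$ and put $$U(x):=\frac{u\left(W^{-1}(x)\right)}{W'\left(W^{-1}(x)\right)},\qquad V(x):=\frac{v\left(W^{-1}(x)\right)}{W'\left(W^{-1}(x)\right)}.$$ If $$\sup_{x>0}x^{-\frac1p}\left(\int_0^x U(t)\left(\left[\mathbf{G}\left(\frac1V\right)\right](t)\right)^{\frac qp}\,\mathrm{d}t\right)^{\frac1q}<+\infty,$$ then there exists a positive finite constant $C$ such that $$\left(\int_0^\infty u(x)\Bigl([\mathbf{M}^g_w f](x)\Bigr)^q\,\mathrm{d}x\right)^{1/q}\le C\left(\int_0^\infty v(x)f(x)^p\,\mathrm{d}x\right)^{1/p}$$ for all positive measurable functions $f$ on $(0,+\infty)$ for which $\mathbf{M}^g_w f$ is defined.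
   Context: A weight on $(0,+\infty)$ is a positive measurable function. The generalized weighted mean operator is $$[\mathbf{M}^g_w f](x)=g^{-1}\left(\frac{1}{W(x)}\int_0^x w(t)\,g(f(t))\,\mathrm{d}t\right),\quad x>0,$$ defined when $w\cdot(g\circ f)$ is integrable on $(0,x)$ for every $x>0$. The geometric mean operator is $$[\mathbf{G}f](x)=\exp\left(\frac1x\int_0^x\ln f(t)\,\mathrm{d}t\right),\quad x>0,$$ and $\mathbf{G}(1/V)$ is assumed to be defined in the weight condition. $W^{-1}$ is the inverse function of $W$ and $W'$ its derivative (equal to $w$ almost everywhere). A (twice differentiable) function $\varphi:(a,b)\to(0,+\infty)$, where $0\le a<b\le+\infty$, belongs to the class $\Phi$ if $\varphi(x)\varphi''(x)\ge[\varphi'(x)]^2$ for all $x$ in its domain. Here $g^{-1}$ is regarded as a function on the open interval $g((0,+\infty))$. Integrals of non-negative functions take values in $[0,+\infty]$. *)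

theory Defs
  imports "HOL-Analysis.Analysis"
begin

text \<open>
  Functions on the half-line are total functions of type \<^typ>\<open>real \<Rightarrow> real\<close> whose values
  outside \<^term>\<open>{0::real<..}\<close> are never used.  Measurability and integrals are with respect to
  Lebesgue measure.
\<close>

definition weight :: "(real \<Rightarrow> real) \<Rightarrow> bool" where
  "weight w \<longleftrightarrow> set_borel_measurable lebesgue {0<..} w \<and> (\<forall>x>0. 0 < w x)"

text \<open>Powers of \<^typ>\<open>ennreal\<close> with a positive real exponent, so that the power of \<open>\<infinity>\<close> is \<open>\<infinity>\<close>.\<close>

definition epowr :: "ennreal \<Rightarrow> real \<Rightarrow> ennreal" where
  "epowr y r = (if y = \<infinity> then \<infinity> else ennreal (enn2real y powr r))"

definition prim :: "(real \<Rightarrow> real) \<Rightarrow> real \<Rightarrow> real" where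
  "prim w x = (LINT s:{0<..<x}|lebesgue. w s)"

definition prim_inv :: "(real \<Rightarrow> real) \<Rightarrow> real \<Rightarrow> real" where
  "prim_inv w = the_inv_into {0<..} (prim w)"

text \<open>
  \<open>U\<close> and \<open>V\<close> arise as \<open>transport w u\<close> and \<open>transport w v\<close>.  On the null set where \<open>prim w\<close> is not
  differentiable at the relevant point, the value is an unspecified real number.
\<close>

definition transport :: "(real \<Rightarrow> real) \<Rightarrow> (real \<Rightarrow> real) \<Rightarrow> real \<Rightarrow> real" where
  "transport w u x = u (prim_inv w x) / deriv (prim w) (prim_inv w x)"

definition geo_mean :: "(real \<Rightarrow> real) \<Rightarrow> real \<Rightarrow> real" where
  "geo_mean h x = exp (1 / x * (LINT t:{0<..<x}|lebesgue. ln (h t)))"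

definition geo_mean_defined :: "(real \<Rightarrow> real) \<Rightarrow> bool" where
  "geo_mean_defined h \<longleftrightarrow> (\<forall>x>0. set_integrable lebesgue {0<..<x} (\<lambda>t. ln (h t)))"

text \<open>
  The inverse of \<open>g\<close> is taken on \<open>g ` {0<..}\<close>; the weighted average to which it is applied
  belongs to that open interval whenever the mean is defined.
\<close>

definition gen_mean :: "(real \<Rightarrow> real) \<Rightarrow> (real \<Rightarrow> real) \<Rightarrow> (real \<Rightarrow> real) \<Rightarrow> real \<Rightarrow> real" where
  "gen_mean g w f x =
     the_inv_into {0<..} g (1 / prim w x * (LINT t:{0<..<x}|lebesgue. w t * g (f t)))"

definition gen_mean_defined :: "(real \<Rightarrow> real) \<Rightarrow> (real \<Rightarrow> real) \<Rightarrow> (real \<Rightarrow> real) \<Rightarrow> bool" where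
  "gen_mean_defined g w f \<longleftrightarrow> (\<forall>x>0. set_integrable lebesgue {0<..<x} (\<lambda>t. w t * g (f t)))"

text \<open>\<open>class_Phi S \<phi>\<close>: the restriction of \<open>\<phi>\<close> to \<open>S\<close>, an open interval, belongs to \<open>\<Phi>\<close>.\<close>

definition class_Phi :: "real set \<Rightarrow> (real \<Rightarrow> real) \<Rightarrow> bool" where
  "class_Phi S \<phi> \<longleftrightarrow>
     (\<exists>a b :: ereal. 0 \<le> a \<and> a < b \<and> S = einterval a b) \<and>
     (\<forall>x\<in>S. 0 < \<phi> x) \<and>
     \<phi> differentiable_on S \<and> deriv \<phi> differentiable_on S \<and>
     (\<forall>x\<in>S. \<phi> x * deriv (deriv \<phi>) x \<ge> (deriv \<phi> x)\<^sup>2)"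

end

theory Submission
  imports Defs
begin

text \<open>
  Since \<open>ln (inverse g)\<close> is convex, Jensen's inequality bounds the generalized mean of \<open>f\<close> by its
  weighted geometric mean.  The substitution \<open>t = W x\<close> turns the latter into the ordinary geometric mean
  of \<open>F = f \<circ> W\<^sup>-\<^sup>1\<close>; it needs \<open>W' = w\<close> almost everywhere, which is obtained from the Vitali covering theorem.
  Writing \<open>h = V F\<^sup>p\<close> and \<open>r = q / p\<close>, the claim becomes \<open>\<integral> B (G h)\<^sup>r \<le> C (\<integral> h)\<^sup>r\<close> with
  \<open>B = U (G (1 / V))\<^sup>r\<close> and \<open>\<integral>\<^sub>0\<^sup>x B \<le> K x\<^sup>r\<close>.  Here \<open>G h (t) \<le> e t\<^sup>-\<^sup>2 \<integral>\<^sub>0\<^sup>t s h(s) ds\<close> and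
  \<open>t\<^sup>-\<^sup>2 \<integral>\<^sub>0\<^sup>t s h(s) ds \<le> t\<^sup>-\<^sup>1 \<integral> h\<close>, so after bounding \<open>r - 1\<close> of the \<open>r\<close> factors the rest is Tonelli's theorem.
  If \<open>\<integral> h\<close> is finite, then \<open>ln F \<le> (h - ln V) / p\<close>, which makes \<open>ln F\<close> locally integrable.
\<close>

subsection \<open>Differentiation of the indefinite integral\<close>

text \<open>One-sided half of Lebesgue differentiation, at level zero. The short intervals need only
  contain \<open>x\<close>, which may also be an endpoint, as difference quotients require.\<close>

lemma AE_small_interval_integral_nonpos:
  fixes k :: "real \<Rightarrow> real"
  assumes k: "integrable lborel k"
  shows "AE x in lborel. k x < 0 \<longrightarrow>
    (\<exists>d>0. \<forall>y z. y \<le> x \<longrightarrow> x \<le> z \<longrightarrow> y < z \<longrightarrow> z - y < d \<longrightarrow> (LBINT s:{y..z}. k s) \<le> 0)"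
proof -
  have [measurable]: "k \<in> borel_measurable borel"
    using k by auto
  \<comment> \<open>Where \<open>k < 0\<close>, an open set of small \<open>P\<close>-measure covers the bad points; a Vitali covering of them
    by intervals with positive integral inside that set has \<open>N\<close>-measure at most its \<open>P\<close>-measure.\<close>
  define P where "P = density lborel (\<lambda>x. ennreal (k x))"
  define N where "N = density lborel (\<lambda>x. ennreal (- k x))"
  have [measurable_cong]: "sets P = sets borel" "sets N = sets borel"
    by (simp_all add: P_def N_def)
  have fin: "(\<integral>\<^sup>+x. ennreal (k x) \<partial>lborel) < \<infinity>"
    using k unfolding real_integrable_def by (simp add: less_top)
  have finite_P: "finite_measure P"
    by (intro finite_measureI) (use fin in \<open>simp add: P_def emeasure_density\<close>)
  have pos_interval: "emeasure N {y..z} \<le> emeasure P {y..z}" if "(LBINT s:{y..z}. k s) > 0" for y z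
  proof -
    have int: "integrable lborel (\<lambda>s. indicator {y..z} s *\<^sub>R k s)"
      using integrable_mult_indicator[OF _ k, of "{y..z}"] by simp
    have P: "emeasure P {y..z} = (\<integral>\<^sup>+s. ennreal (indicator {y..z} s *\<^sub>R k s) \<partial>lborel)"
      by (simp add: P_def emeasure_density) (intro nn_integral_cong, simp split: split_indicator)
    have N: "emeasure N {y..z} = (\<integral>\<^sup>+s. ennreal (- (indicator {y..z} s *\<^sub>R k s)) \<partial>lborel)"
      by (simp add: N_def emeasure_density) (intro nn_integral_cong, simp split: split_indicator)
    have fin: "emeasure P {y..z} \<noteq> \<infinity>" "emeasure N {y..z} \<noteq> \<infinity>"
      using int unfolding P N real_integrable_def by auto
    have "(LBINT s:{y..z}. k s) = enn2real (emeasure P {y..z}) - enn2real (emeasure N {y..z})"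
      unfolding set_lebesgue_integral_def P N using real_lebesgue_integral_def[OF int] .
    with that have "enn2real (emeasure N {y..z}) \<le> enn2real (emeasure P {y..z})"
      by simp
    with fin show ?thesis
      by (metis ennreal_enn2real ennreal_leI infinity_ennreal_def less_top)
  qed
  define A where "A = {x. k x < 0}"
  have [measurable]: "A \<in> sets borel"
    unfolding A_def by measurable
  have PA: "emeasure P A = 0"
    unfolding P_def A_def
    by (simp add: emeasure_density nn_integral_0_iff_AE)
       (auto intro!: AE_I2 split: split_indicator simp: ennreal_neg)
  define E where "E = {x \<in> A. \<forall>d>0. \<exists>y z. y \<le> x \<and> x \<le> z \<and> y < z \<and> z - y < d \<and> (LBINT s:{y..z}. k s) > 0}"
  have cover: "\<exists>Z\<in>sets borel. E \<subseteq> Z \<and> emeasure N Z \<le> ennreal e" if "e > 0" for e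
  proof -
    \<comment> \<open>\<open>P\<close> gives \<open>A\<close> no mass, since the positive part of
      \<open>k\<close> vanishes there. Outer regularity then provides an open neighbourhood of
      \<open>A\<close> of small \<open>P\<close>-measure.\<close>
    have "(INF G\<in>{G. A \<subseteq> G \<and> open G}. emeasure P G) < ennreal e"
      using outer_regular[of P A] finite_P PA \<open>e > 0\<close> \<open>A \<in> sets borel\<close>
      by (simp add: P_def finite_measure.emeasure_finite)
    then obtain G where G: "A \<subseteq> G" "open G" "emeasure P G < ennreal e"
      by (auto simp: INF_less_iff)
    define K where "K = {(y, z). y < z \<and> {y..z} \<subseteq> G \<and> (LBINT s:{y..z}. k s) > 0}"
    \<comment> \<open>Midpoint and half-length present the intervals as closed balls, the shape used
      by the Vitali covering theorem.\<close>
    define c where "c i = (fst i + snd i) / 2" for i :: "real \<times> real"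
    define r where "r i = (snd i - fst i) / 2" for i :: "real \<times> real"
    have cball: "cball (c i) (r i) = {fst i..snd i}" for i
      unfolding c_def r_def cball_eq_atLeastAtMost by (simp add: field_simps)
    have r: "0 < r i" if "i \<in> K" for i
      using that by (auto simp: K_def r_def)
    have vit: "\<exists>i. i \<in> K \<and> x \<in> cball (c i) (r i) \<and> r i < d" if "x \<in> E" "0 < d" for x d
    proof -
      have "x \<in> G" using that G by (auto simp: E_def)
      then obtain \<epsilon> where \<epsilon>: "\<epsilon> > 0" "ball x \<epsilon> \<subseteq> G"
        using \<open>open G\<close> by (meson open_contains_ball)
      from that \<epsilon>(1) obtain y z where yz: "y \<le> x" "x \<le> z" "y < z" "z - y < min d \<epsilon>"
          "(LBINT s:{y..z}. k s) > 0"
        unfolding E_def by (smt (verit) mem_Collect_eq)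
      then have "{y..z} \<subseteq> ball x \<epsilon>"
        by (auto simp: dist_real_def)
      with yz \<epsilon> have "(y, z) \<in> K"
        by (auto simp: K_def)
      moreover have "x \<in> cball (c (y, z)) (r (y, z))" "r (y, z) < d"
        unfolding cball using yz by (auto simp: r_def)
      ultimately show ?thesis by blast
    qed
    obtain C where C: "countable C" "C \<subseteq> K"
      "pairwise (\<lambda>i j. disjnt (cball (c i) (r i)) (cball (c j) (r j))) C"
      "negligible (E - (\<Union>i\<in>C. cball (c i) (r i)))"
      using Vitali_covering_theorem_cballs[of K r E c] r vit by blast
    define I where "I = (\<Union>i\<in>C. {fst i..snd i})"
    have [measurable]: "I \<in> sets borel"
      unfolding I_def using C(1) by auto
    have disj: "disjoint_family_on (\<lambda>i. {fst i..snd i}) C"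
      using C(3) unfolding cball pairwise_def disjnt_def disjoint_family_on_def by auto
    have "emeasure N I = (\<integral>\<^sup>+i. emeasure N {fst i..snd i} \<partial>count_space C)"
      unfolding I_def using C(1) disj by (intro emeasure_UN_countable) auto
    also have "\<dots> \<le> (\<integral>\<^sup>+i. emeasure P {fst i..snd i} \<partial>count_space C)"
      using C(2) by (intro nn_integral_mono pos_interval) (auto simp: K_def)
    also have "\<dots> = emeasure P I"
      unfolding I_def using C(1) disj by (intro emeasure_UN_countable[symmetric]) auto
    also have "\<dots> \<le> emeasure P G"
      using C(2) G(2) by (intro emeasure_mono) (fastforce simp: I_def K_def)+
    finally have NI: "emeasure N I \<le> ennreal e"
      using G by simp
    \<comment> \<open>No measurability of \<open>E\<close> is established, so the part left
      uncovered is enclosed in a Borel null set \<open>Y\<close>.\<close>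
    have "E - I \<in> null_sets lebesgue"
      using C(4) unfolding I_def cball by (simp add: negligible_iff_null_sets)
    then obtain Y where Y: "Y \<in> null_sets lborel" "E - I \<subseteq> Y"
      by (auto simp: null_sets_completion_iff2)
    have YN: "emeasure N Y = 0"
      using Y(1) unfolding N_def
      by (intro absolutely_continuousI_density[THEN absolutely_continuousD]) (auto simp: absolutely_continuous_def null_sets_def)
    have "emeasure N (I \<union> Y) \<le> emeasure N I + emeasure N Y"
      using Y by (intro emeasure_subadditive) auto
    with NI YN have "emeasure N (I \<union> Y) \<le> ennreal e" by simp
    moreover have "E \<subseteq> I \<union> Y" "I \<union> Y \<in> sets borel" using Y by auto
    ultimately show ?thesis by blast
  qed
  have "\<forall>n. \<exists>Z. Z \<in> sets borel \<and> E \<subseteq> Z \<and> emeasure N Z \<le> ennreal (1 / Suc n)"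
    using cover[of "1 / real (Suc n)" for n] by (simp del: of_nat_Suc) blast
  then obtain Z where Z: "\<And>n. Z n \<in> sets borel" "\<And>n. E \<subseteq> Z n" "\<And>n. emeasure N (Z n) \<le> ennreal (1 / Suc n)"
    by metis
  have [measurable]: "(\<Inter>n. Z n) \<in> sets borel"
    using Z(1) by auto
  have "emeasure N (\<Inter>n. Z n) \<le> ennreal (1 / Suc n)" for n
    using Z(1) by (intro order.trans[OF emeasure_mono Z(3)[of n]]) auto
  moreover have "(\<lambda>n. ennreal (1 / Suc n)) \<longlonglongrightarrow> ennreal 0"
    by (intro tendsto_ennrealI LIMSEQ_Suc lim_1_over_n)
  ultimately have "emeasure N (\<Inter>n. Z n) \<le> 0"
    using LIMSEQ_le_const[of _ "ennreal 0"] by (metis ennreal_0)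
  then have "AE x in N. x \<notin> (\<Inter>n. Z n)"
    by (intro AE_not_in null_setsI) (simp_all add: \<open>sets N = sets borel\<close> Z(1) sets.countable_INT'')
  \<comment> \<open>The density of \<open>N\<close> is positive exactly where \<open>k < 0\<close>,
    so there an \<open>N\<close>-null exceptional set is also Lebesgue-null.\<close>
  then have "AE x in lborel. 0 < ennreal (- k x) \<longrightarrow> x \<notin> (\<Inter>n. Z n)"
    unfolding N_def by (subst (asm) AE_density) auto
  then show ?thesis
  proof eventually_elim
    case (elim x)
    show ?case
    proof
      assume "k x < 0"
      with elim Z(2) have "x \<notin> E" by auto
      with \<open>k x < 0\<close> show "\<exists>d>0. \<forall>y z. y \<le> x \<longrightarrow> x \<le> z \<longrightarrow> y < z \<longrightarrow> z - y < d \<longrightarrow> (LBINT s:{y..z}. k s) \<le> 0"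
        unfolding E_def A_def by (force simp: not_less)
    qed
  qed
qed

text \<open>Compare \<open>k\<close> with each rational constant, truncating to bounded intervals.\<close>

lemma AE_small_interval_integral_le:
  fixes k :: "real \<Rightarrow> real"
  assumes k: "\<And>a b. set_integrable lborel {a..b} k"
  shows "AE x in lborel. \<forall>e>0. \<exists>d>0. \<forall>y z. y \<le> x \<longrightarrow> x \<le> z \<longrightarrow> y < z \<longrightarrow> z - y < d \<longrightarrow>
    (LBINT s:{y..z}. k s) \<le> (k x + e) * (z - y)"
proof -
  define h where "h n b s = indicator {-real n..real n} s * (k s - b)" for n b s
  have h: "integrable lborel (h n b)" for n b
  proof -
    have "set_integrable lborel {-real n..real n} (\<lambda>s. k s - b)"
      by (intro set_integral_diff k) (simp add: set_integrable_def)
    then show ?thesis by (simp add: h_def[abs_def] set_integrable_def)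
  qed
  have "AE x in lborel. \<forall>n. \<forall>b\<in>\<rat>. h n b x < 0 \<longrightarrow>
    (\<exists>d>0. \<forall>y z. y \<le> x \<longrightarrow> x \<le> z \<longrightarrow> y < z \<longrightarrow> z - y < d \<longrightarrow> (LBINT s:{y..z}. h n b s) \<le> 0)"
    unfolding AE_all_countable
    by (intro allI AE_ball_countable[THEN iffD2] ballI AE_small_interval_integral_nonpos h) (rule countable_rat)
  then show ?thesis
  proof eventually_elim
    case (elim x)
    show ?case
    proof (intro allI impI)
      fix e :: real assume "e > 0"
      then obtain b where b: "b \<in> \<rat>" "k x < b" "b < k x + e"
        using Rats_dense_in_real[of "k x" "k x + e"] by auto
      \<comment> \<open>The margin 1 matches the length bound \<open>min d 1\<close> below: every
        interval considered lies inside \<open>{-real n..real n}\<close>, where the truncation has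
        no effect.\<close>
      obtain n where n: "real n > \<bar>x\<bar> + 1"
        using reals_Archimedean2 by blast
      then have "h n b x < 0"
        using b by (auto simp: h_def indicator_def)
      with elim b obtain d where d: "d > 0" and dd: "\<And>y z. y \<le> x \<Longrightarrow> x \<le> z \<Longrightarrow> y < z \<Longrightarrow> z - y < d \<Longrightarrow> (LBINT s:{y..z}. h n b s) \<le> 0"
        by blast
      show "\<exists>d>0. \<forall>y z. y \<le> x \<longrightarrow> x \<le> z \<longrightarrow> y < z \<longrightarrow> z - y < d \<longrightarrow>
        (LBINT s:{y..z}. k s) \<le> (k x + e) * (z - y)"
      proof (intro exI[of _ "min d 1"] conjI allI impI)
        fix y z assume yz: "y \<le> x" "x \<le> z" "y < z" "z - y < min d 1"
        then have "0 \<ge> (LBINT s:{y..z}. h n b s)"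
          using dd by simp
        also have "(LBINT s:{y..z}. h n b s) = (LBINT s:{y..z}. k s - b)"
          using n yz by (intro set_lebesgue_integral_cong) (auto simp: h_def indicator_def)
        also have "\<dots> = (LBINT s:{y..z}. k s) - (LBINT s:{y..z}. b)"
          using yz by (intro set_integral_diff k) (auto simp: set_integrable_def)
        also have "(LBINT s:{y..z}. b) = b * (z - y)"
          using yz by (simp add: set_lebesgue_integral_def)
        finally have "(LBINT s:{y..z}. k s) \<le> b * (z - y)" by simp
        also have "\<dots> \<le> (k x + e) * (z - y)"
          using b yz by (intro mult_right_mono) auto
        finally show "(LBINT s:{y..z}. k s) \<le> (k x + e) * (z - y)" .
      qed (use d in auto)
    qed
  qed
qed

text \<open>The upper estimate is applied to \<open>k\<close> and to \<open>- k\<close>; together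
  they control the difference quotients from both sides.\<close>

lemma AE_has_derivative_indefinite_integral:
  fixes k :: "real \<Rightarrow> real"
  assumes k: "\<And>a b. set_integrable lborel {a..b} k"
  shows "AE x in lborel. x > 0 \<longrightarrow> ((\<lambda>x. LBINT s:{0<..<x}. k s) has_real_derivative k x) (at x)"
proof -
  have k': "set_integrable lborel {a..b} (\<lambda>s. - k s)" for a b
    using k[of a b] by (simp add: set_integrable_def)
  show ?thesis
    using AE_small_interval_integral_le[OF k] AE_small_interval_integral_le[OF k']
  proof eventually_elim
    case (elim x)
    show ?case
    proof
      assume "x > 0"
      let ?W = "\<lambda>x. LBINT s:{0<..<x}. k s"
      have ae: "(LBINT s:A. k s) = (LBINT s:B. k s)"
        if "A \<subseteq> {a..b}" "B \<subseteq> {a..b}" "A \<in> sets lborel" "B \<in> sets lborel" "AE s in lborel. s \<in> A \<longleftrightarrow> s \<in> B" for A B a b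
      proof -
        have "set_integrable lborel A k" "set_integrable lborel B k"
          using set_integrable_subset[OF k[of a b]] that by auto
        then show ?thesis
          unfolding set_integrable_def set_lebesgue_integral_def
          by (intro integral_cong_AE borel_measurable_integrable)
             (use that(5) in \<open>auto split: split_indicator\<close>)
      qed
      have diff: "?W z - ?W y = (LBINT s:{y..z}. k s)" if "0 < y" "y \<le> z" for y z
      proof -
        have "?W z = (LBINT s:{0..<y} \<union> {y..z}. k s)"
          proof (rule ae[of _ 0 z])
          show "AE s in lborel. s \<in> {0<..<z} \<longleftrightarrow> s \<in> {0..<y} \<union> {y..z}"
            using AE_lborel_singleton[of 0] AE_lborel_singleton[of z]
            by eventually_elim (use that in auto)
        qed (use that in auto)
        also have "\<dots> = (LBINT s:{0..<y}. k s) + (LBINT s:{y..z}. k s)"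
          using that by (intro set_integral_Un set_integrable_subset[OF k[of 0 z]]) auto
        also have "(LBINT s:{0..<y}. k s) = ?W y"
          by (rule ae[of _ 0 y]) (use AE_lborel_singleton[of 0] that in \<open>auto elim!: eventually_mono\<close>)
        finally show ?thesis by simp
      qed
      show "(?W has_real_derivative k x) (at x)"
        unfolding has_field_derivative_def has_derivative_at_alt
      proof (intro conjI allI impI)
        fix e :: real assume "e > 0"
        from elim(1) this obtain d1 where d1: "d1 > 0" "\<And>y z. y \<le> x \<Longrightarrow> x \<le> z \<Longrightarrow> y < z \<Longrightarrow> z - y < d1 \<Longrightarrow>
            (LBINT s:{y..z}. k s) \<le> (k x + e) * (z - y)" by blast
        from elim(2) \<open>e > 0\<close> obtain d2 where d2: "d2 > 0" "\<And>y z. y \<le> x \<Longrightarrow> x \<le> z \<Longrightarrow> y < z \<Longrightarrow> z - y < d2 \<Longrightarrow>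
            (LBINT s:{y..z}. - k s) \<le> (- k x + e) * (z - y)" by blast
        have est: "\<bar>(LBINT s:{y..z}. k s) - k x * (z - y)\<bar> \<le> e * (z - y)"
          if "y \<le> x" "x \<le> z" "y < z" "z - y < min d1 d2" for y z
          using d1(2)[of y z] d2(2)[of y z] that by (auto simp: algebra_simps set_lebesgue_integral_def)
        show "\<exists>d>0. \<forall>y. norm (y - x) < d \<longrightarrow> norm (?W y - ?W x - k x * (y - x)) \<le> e * norm (y - x)"
        \<comment> \<open>The bound \<open>x\<close> on the radius keeps \<open>y\<close> positive,
          as \<open>diff\<close> requires.\<close>
        proof (intro exI[of _ "min (min d1 d2) x"] conjI allI impI)
          fix y assume y: "norm (y - x) < min (min d1 d2) x"
          consider "y = x" | "y < x" | "x < y" by linarith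
          then show "norm (?W y - ?W x - k x * (y - x)) \<le> e * norm (y - x)"
          proof cases
            case 2
            with y est[of y x] diff[of y x] \<open>x > 0\<close> show ?thesis
              by (auto simp: algebra_simps)
          next
            case 3
            with y est[of x y] diff[of x y] \<open>x > 0\<close> show ?thesis
              by (auto simp: algebra_simps)
          qed simp
        qed (use d1 d2 \<open>x > 0\<close> in auto)
      qed (rule bounded_linear_mult_right)
    qed
  qed
qed

subsection \<open>The substitution \<open>t = W x\<close>\<close>

lemma set_integral_pos:
  fixes f :: "real \<Rightarrow> real"
  assumes "a < b" and int: "set_integrable lborel {a<..<b} f"
    and pos: "\<And>s. a < s \<Longrightarrow> s < b \<Longrightarrow> 0 < f s"
  shows "0 < (LBINT s:{a<..<b}. f s)"
proof -
  have nonneg: "AE s in lborel. 0 \<le> indicator {a<..<b} s *\<^sub>R f s"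
    using pos by (intro AE_I2) (auto split: split_indicator simp: less_imp_le)
  have "(LBINT s:{a<..<b}. f s) \<noteq> 0"
  proof
    assume "(LBINT s:{a<..<b}. f s) = 0"
    then have "AE s in lborel. indicator {a<..<b} s *\<^sub>R f s = 0"
      using int nonneg unfolding set_lebesgue_integral_def set_integrable_def
      by (subst (asm) integral_nonneg_eq_0_iff_AE) auto
    then have "AE s in lborel. s \<notin> {a<..<b}"
      by eventually_elim (use pos in \<open>force split: split_indicator_asm\<close>)
    then have "emeasure lborel {a<..<b} = 0"
      by (subst (asm) AE_iff_measurable[of "{a<..<b}"]) auto
    with \<open>a < b\<close> show False by simp
  qed
  moreover have "0 \<le> (LBINT s:{a<..<b}. f s)"
    unfolding set_lebesgue_integral_def by (rule integral_nonneg_AE[OF nonneg])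
  ultimately show ?thesis by simp
qed

lemma measurable_set_integral_Ioo [measurable]:
  fixes f :: "real \<Rightarrow> real"
  assumes [measurable]: "f \<in> borel_measurable borel"
  shows "(\<lambda>t. LBINT s:{0<..<t}. f s) \<in> borel_measurable borel"
proof -
  have [measurable]: "Measurable.pred (borel \<Otimes>\<^sub>M borel) (\<lambda>x::real \<times> real. snd x \<in> {0<..<fst x})"
    unfolding greaterThanLessThan_iff by measurable
  show ?thesis
    unfolding set_lebesgue_integral_def by measurable
qed

text \<open>The weight is Borel and positive on the whole line, so that all arguments can run over
  \<open>lborel\<close>. A Borel representative of the given weight is substituted later.\<close>

locale time_change =
  fixes w :: "real \<Rightarrow> real"
  assumes w_measurable [measurable]: "w \<in> borel_measurable borel"
    and w_pos: "\<And>x. 0 < w x"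
    and w_integrable: "\<And>x. 0 < x \<Longrightarrow> set_integrable lborel {0<..<x} w"
    and w_infinite: "(\<integral>\<^sup>+s\<in>{0<..}. ennreal (w s) \<partial>lborel) = \<infinity>"
begin

definition W :: "real \<Rightarrow> real" where
  "W x = (LBINT s:{0<..<x}. w s)"

text \<open>The value 0 on the non-positive half-line makes \<open>J\<close> monotone on the whole
  line, hence Borel measurable.\<close>

definition J :: "real \<Rightarrow> real" where
  "J t = (if 0 < t then the_inv_into {0<..} W t else 0)"

section \<open>\<open>W\<close> as an increasing continuous bijection of the half-line\<close>

lemma W_measurable [measurable]: "W \<in> borel_measurable borel"
  unfolding W_def[abs_def] by measurable

lemma W_nonpos: "x \<le> 0 \<Longrightarrow> W x = 0"
  by (simp add: W_def set_lebesgue_integral_def)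

lemma W_pos: "0 < x \<Longrightarrow> 0 < W x"
  unfolding W_def by (intro set_integral_pos w_integrable w_pos)

lemma W_less:
  assumes "0 < x" "x < y"
  shows "W x < W y"
proof -
  have "W y = (LBINT s:{0<..<x} \<union> {x..<y}. w s)"
    unfolding W_def using assms by (intro arg_cong[where f="\<lambda>A. set_lebesgue_integral lborel A w"]) auto
  also have "\<dots> = W x + (LBINT s:{x..<y}. w s)"
    unfolding W_def using assms
    by (intro set_integral_Un set_integrable_subset[OF w_integrable[of y]]) auto
  finally have "W y = W x + (LBINT s:{x..<y}. w s)" .
  moreover have "(LBINT s:{x..<y}. w s) = (LBINT s:{x<..<y}. w s)"
    by (rule set_integral_cong_set)
       (use AE_lborel_singleton[of x] in \<open>auto simp: set_borel_measurable_def elim!: eventually_mono\<close>)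
  moreover have "0 < (LBINT s:{x<..<y}. w s)"
    using assms w_pos by (intro set_integral_pos set_integrable_subset[OF w_integrable[of y]]) auto
  ultimately show ?thesis by linarith
qed

lemma inj_on_W: "inj_on W {0<..}"
  by (rule linorder_inj_onI) (use W_less in force)+

text \<open>\<open>W\<close> is the distribution function of the measure with density
  \<open>w\<close> on the half-line; this form serves both the unboundedness of \<open>W\<close> and
  the identification of the image measure under \<open>J\<close>.\<close>

lemma W_eq_emeasure: "emeasure (density lborel (\<lambda>x. ennreal (w x * indicator {0<..} x))) {..x} = ennreal (W x)"
proof (cases "0 < x")
  case True
  have "emeasure (density lborel (\<lambda>x. ennreal (w x * indicator {0<..} x))) {..x}
      = (\<integral>\<^sup>+s. ennreal (indicator {0<..<x} s *\<^sub>R w s) \<partial>lborel)"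
    using AE_lborel_singleton[of x]
    by (subst emeasure_density) (auto intro!: nn_integral_cong_AE elim!: eventually_mono split: split_indicator)
  also have "\<dots> = ennreal (W x)"
    unfolding W_def set_lebesgue_integral_def
    by (rule nn_integral_eq_integral)
       (use w_integrable[OF True] w_pos in \<open>auto simp: set_integrable_def less_imp_le\<close>)
  finally show ?thesis .
next
  case False
  then have "emeasure (density lborel (\<lambda>x. ennreal (w x * indicator {0<..} x))) {..x} = 0"
    by (simp add: emeasure_density nn_integral_0_iff_AE) (auto intro!: AE_I2 split: split_indicator)
  with False show ?thesis by (simp add: W_nonpos)
qed

lemma continuous_on_W: "continuous_on {0..b} W"
proof (cases "0 < b")
  case True
  have "W x = integral {0..x} w" if "x \<in> {0..b}" for x
  proof (cases "x = 0")
    case False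
    then have "W x = integral {0<..<x} w"
      unfolding W_def using that by (intro set_borel_integral_eq_integral(2) w_integrable) auto
    then show ?thesis
      using integral_open_interval_real[of 0 x w] by simp
  qed (simp add: W_nonpos)
  moreover have "w integrable_on {0..b}"
    using set_borel_integral_eq_integral(1)[OF w_integrable[OF True]] integrable_on_Icc_iff_Ioo[of w 0 b] by simp
  ultimately show ?thesis
    using continuous_on_cong[of "{0..b}" "{0..b}" W "\<lambda>x. integral {0..x} w"] indefinite_integral_continuous_1[of w 0 b]
    by simp
next
  case False
  then have "{0..b} = {} \<or> {0..b} = {0}" by auto
  then show ?thesis by auto
qed

text \<open>Otherwise continuity from below along \<open>{..real n}\<close> would bound the total
  mass, which is infinite by \<open>w_infinite\<close>.\<close>

lemma W_unbounded: "\<exists>x>0. t < W x"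
proof (rule ccontr)
  assume *: "\<not> ?thesis"
  let ?D = "density lborel (\<lambda>x. ennreal (w x * indicator {0<..} x))"
  have "(SUP n. emeasure ?D {..real n}) = emeasure ?D (\<Union>n. {..real n})"
    by (intro SUP_emeasure_incseq) (auto simp: incseq_def)
  also have "(\<Union>n. {..real n}) = UNIV"
    by (auto simp: real_arch_simple)
  also have "emeasure ?D UNIV = (\<integral>\<^sup>+s\<in>{0<..}. ennreal (w s) \<partial>lborel)"
    by (subst emeasure_density) (auto intro!: nn_integral_cong split: split_indicator)
  finally have top: "(SUP n. emeasure ?D {..real n}) = \<infinity>"
    using w_infinite by simp
  have "emeasure ?D {..real n} \<le> ennreal \<bar>t\<bar>" for n
  proof -
    have "W (real n) \<le> \<bar>t\<bar>"
    proof (cases "n = 0")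
      case False
      with * have "W (real n) \<le> t"
        by (meson not_less of_nat_0_less_iff neq0_conv)
      then show ?thesis by simp
    qed (simp add: W_nonpos)
    then show ?thesis
      unfolding W_eq_emeasure by (rule ennreal_leI)
  qed
  then have "(SUP n. emeasure ?D {..real n}) \<le> ennreal \<bar>t\<bar>"
    by (rule SUP_least)
  then show False unfolding top by (simp add: top_unique)
qed

lemma W_surj:
  assumes "0 < t"
  shows "\<exists>x>0. W x = t"
proof -
  obtain b where b: "0 < b" "t < W b" using W_unbounded by blast
  then have "\<exists>x. 0 \<le> x \<and> x \<le> b \<and> W x = t"
    using assms continuous_on_W W_nonpos[of 0] by (intro IVT') auto
  with assms W_nonpos show ?thesis
    by (metis less_eq_real_def less_irrefl)
qed

section \<open>The inverse \<open>J\<close> and its measurability\<close>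

lemma J_W: "0 < x \<Longrightarrow> J (W x) = x"
  by (simp add: J_def W_pos the_inv_into_f_f inj_on_W)

lemma J_pos: "0 < t \<Longrightarrow> 0 < J t" and W_J: "0 < t \<Longrightarrow> W (J t) = t"
  using W_surj[of t] J_W by metis+

lemma less_J_iff: "0 < t \<Longrightarrow> 0 < x \<Longrightarrow> J t < x \<longleftrightarrow> t < W x"
  using W_less[of "J t" x] W_less[of x "J t"] J_pos[of t] W_J[of t]
  by (cases "J t" x rule: linorder_cases) auto

lemma J_measurable [measurable]: "J \<in> borel_measurable borel"
proof (rule borel_measurable_mono, rule monoI)
  fix s t :: real assume "s \<le> t"
  consider "s \<le> 0" "t \<le> 0" | "s \<le> 0" "0 < t" | "0 < s" "0 < t" using \<open>s \<le> t\<close> by linarith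
  then show "J s \<le> J t"
  proof cases
    case 2 then show ?thesis using J_pos[of t] by (simp add: J_def)
  next
    case 3 then show ?thesis
      using less_J_iff[of t "J s"] J_pos[of s] W_J[of s] \<open>s \<le> t\<close> by force
  qed (simp add: J_def)
qed

text \<open>Both measures give \<open>{..x}\<close> the mass \<open>W x\<close>, because
  \<open>J t \<le> x\<close> means \<open>t \<le> W x\<close> for positive \<open>t\<close>, and
  half-lines determine a measure. This yields the change of variables without differentiating
  \<open>W\<close>.\<close>

lemma distr_J:
  "distr (density lborel (\<lambda>t. ennreal (indicator {0<..} t))) borel J
    = density lborel (\<lambda>x. ennreal (w x * indicator {0<..} x))" (is "?L = ?R")
proof (rule measure_eqI_generator_eq_countable)
  let ?E = "range (\<lambda>a::real. {..a})"
  show "Int_stable ?E"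
    by (auto simp: Int_stable_def)
  show "?E \<subseteq> Pow UNIV" "sets ?L = sigma_sets UNIV ?E" "sets ?R = sigma_sets UNIV ?E"
    by (auto simp: borel_eq_atMost)
  show "range (\<lambda>n. {..real n}) \<subseteq> ?E" "\<Union>(range (\<lambda>n. {..real n})) = UNIV" "countable (range (\<lambda>n. {..real n}))"
    by (auto simp: real_arch_simple)
  have eq: "emeasure ?L {..x} = ennreal (W x)" for x
  proof -
    have "emeasure ?L {..x} = (\<integral>\<^sup>+t. ennreal (indicator {0<..} t) * indicator (J -` {..x}) t \<partial>lborel)"
      by (simp add: emeasure_distr emeasure_density measurable_sets_borel[OF J_measurable])
    also have "\<dots> = (\<integral>\<^sup>+t. indicator {0<..W x} t \<partial>lborel)"
    proof (intro nn_integral_cong)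
      fix t
      have "J t \<le> x \<longleftrightarrow> t \<le> W x" if "0 < t"
        using that J_pos[of t] W_nonpos[of x] W_J[of t] W_less[of x "J t"] W_less[of "J t" x]
        by (cases "0 < x"; cases "J t" x rule: linorder_cases) auto
      then show "ennreal (indicator {0<..} t) * indicator (J -` {..x}) t = indicator {0<..W x} t"
        by (auto split: split_indicator)
    qed
    finally show ?thesis using W_pos[of x] W_nonpos[of x] by (cases "x > 0") auto
  qed
  show "emeasure ?L X = emeasure ?R X" if "X \<in> ?E" for X
    using that by (auto simp: eq W_eq_emeasure)
  show "emeasure ?L X \<noteq> \<infinity>" if "X \<in> range (\<lambda>n. {..real n})" for X
    using that by (auto simp: eq)
qed

section \<open>Transfer of integrals and null sets along \<open>J\<close>\<close>

lemma nn_integral_time_change: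
  assumes [measurable]: "\<Psi> \<in> borel_measurable borel"
  shows "(\<integral>\<^sup>+x\<in>{0<..}. ennreal (w x) * \<Psi> x \<partial>lborel) = (\<integral>\<^sup>+t\<in>{0<..}. \<Psi> (J t) \<partial>lborel)"
proof -
  have "(\<integral>\<^sup>+t\<in>{0<..}. \<Psi> (J t) \<partial>lborel) = (\<integral>\<^sup>+x. \<Psi> x \<partial>distr (density lborel (\<lambda>t. ennreal (indicator {0<..} t))) borel J)"
    by (subst nn_integral_distr) (auto simp: nn_integral_density intro!: nn_integral_cong split: split_indicator)
  also have "\<dots> = (\<integral>\<^sup>+x\<in>{0<..}. ennreal (w x) * \<Psi> x \<partial>lborel)"
    unfolding distr_J by (subst nn_integral_density) (auto intro!: nn_integral_cong split: split_indicator)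
  finally show ?thesis by simp
qed

lemma set_integral_time_change:
  fixes \<Psi> :: "real \<Rightarrow> real"
  assumes [measurable]: "\<Psi> \<in> borel_measurable borel" and "0 < x"
  shows "set_integrable lborel {0<..<x} (\<lambda>s. w s * \<Psi> s) \<longleftrightarrow> set_integrable lborel {0<..<W x} (\<lambda>t. \<Psi> (J t))"
    and "(LBINT s:{0<..<x}. w s * \<Psi> s) = (LBINT t:{0<..<W x}. \<Psi> (J t))"
proof -
  let ?L = "density lborel (\<lambda>t. ennreal (indicator {0<..} t))"
  let ?f = "\<lambda>s. indicator {0<..<x} s * \<Psi> s"
  \<comment> \<open>Within the positive half-line, \<open>J\<close> pulls \<open>{0<..<x}\<close>
    back to \<open>{0<..<W x}\<close>.\<close>
  have J: "indicator {0<..} t * (indicator {0<..<x} (J t) * \<Psi> (J t)) = indicator {0<..<W x} t * \<Psi> (J t)" for t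
    using \<open>0 < x\<close> less_J_iff[of t x] J_pos[of t] by (auto split: split_indicator)
  have w: "w s * indicator {0<..} s * (indicator {0<..<x} s * \<Psi> s) = indicator {0<..<x} s * (w s * \<Psi> s)" for s
    by (auto split: split_indicator)
  have "integrable (distr ?L borel J) ?f \<longleftrightarrow> integrable lborel (\<lambda>t. indicator {0<..<W x} t * \<Psi> (J t))"
    by (subst integrable_distr_eq) (auto simp: integrable_density J)
  moreover have "integrable (distr ?L borel J) ?f \<longleftrightarrow> integrable lborel (\<lambda>s. indicator {0<..<x} s * (w s * \<Psi> s))"
    unfolding distr_J using w_pos by (subst integrable_density) (auto simp: w less_imp_le)
  ultimately show "set_integrable lborel {0<..<x} (\<lambda>s. w s * \<Psi> s) \<longleftrightarrow> set_integrable lborel {0<..<W x} (\<lambda>t. \<Psi> (J t))"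
    by (simp add: set_integrable_def)
  have "(\<integral>s. ?f s \<partial>distr ?L borel J) = (LBINT t:{0<..<W x}. \<Psi> (J t))"
    by (subst integral_distr) (auto simp: integral_density J set_lebesgue_integral_def)
  moreover have "(\<integral>s. ?f s \<partial>distr ?L borel J) = (LBINT s:{0<..<x}. w s * \<Psi> s)"
    unfolding distr_J using w_pos by (subst integral_density) (auto simp: w less_imp_le set_lebesgue_integral_def)
  ultimately show "(LBINT s:{0<..<x}. w s * \<Psi> s) = (LBINT t:{0<..<W x}. \<Psi> (J t))"
    by simp
qed

text \<open>By \<open>distr_J\<close> the image under \<open>J\<close> of Lebesgue measure on the
  half-line has a density, so preimages of null sets are null there.\<close>

lemma AE_time_change:
  assumes "AE x in lborel. 0 < x \<longrightarrow> P x"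
  shows "AE t in lborel. 0 < t \<longrightarrow> P (J t)"
proof -
  have "AE x in density lborel (\<lambda>x. ennreal (w x * indicator {0<..} x)). P x"
    using assms by (subst AE_density) (auto elim!: eventually_mono split: split_indicator_asm)
  then have "AE t in density lborel (\<lambda>t. ennreal (indicator {0<..} t)). P (J t)"
    unfolding distr_J[symmetric] by (rule AE_distrD[rotated]) measurable
  then show ?thesis
    by (subst (asm) AE_density) (auto elim!: eventually_mono split: split_indicator_asm)
qed

lemma AE_deriv_W: "AE x in lborel. 0 < x \<longrightarrow> deriv W x = w x"
proof -
  \<comment> \<open>The locale controls the integral of \<open>w\<close> only on the positive
    half-line. Extension by zero gives a function integrable on every bounded interval with the same
    primitive.\<close>
  define k where "k s = indicator {0<..} s * w s" for s
  have "set_integrable lborel {a..b} k" for a b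
  proof -
    have "set_integrable lborel ({a..b} \<inter> {0<..}) w"
      by (rule set_integrable_subset[OF w_integrable[of "\<bar>b\<bar> + 1"]]) auto
    then show ?thesis
      by (simp add: set_integrable_def k_def[abs_def] indicator_inter_arith mult.assoc)
  qed
  from AE_has_derivative_indefinite_integral[OF this]
  have "AE x in lborel. 0 < x \<longrightarrow> ((\<lambda>x. LBINT s:{0<..<x}. k s) has_real_derivative k x) (at x)" .
  moreover have "(\<lambda>x. LBINT s:{0<..<x}. k s) = W"
    unfolding W_def[abs_def] by (intro ext set_lebesgue_integral_cong) (auto simp: k_def)
  ultimately show ?thesis
    by (auto elim!: eventually_mono intro!: DERIV_imp_deriv simp: k_def)
qed

end

subsection \<open>A weighted inequality for the geometric mean\<close>

lemma nn_integral_powr_tail: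
  assumes "0 < a" "0 < s"
  shows "(\<integral>\<^sup>+y\<in>{s<..}. ennreal (a * y powr (- a - 1)) \<partial>lborel) = ennreal (s powr (- a))"
proof -
  have "(\<integral>\<^sup>+y\<in>{s<..}. ennreal (a * y powr (- a - 1)) \<partial>lborel)
      = (\<integral>\<^sup>+y. ennreal (a * y powr (- a - 1)) * indicator {s..} y \<partial>lborel)"
    using AE_lborel_singleton[of s]
    by (intro nn_integral_cong_AE) (auto elim!: eventually_mono split: split_indicator)
  also have "\<dots> = ennreal (0 - (- (s powr (- a))))"
  proof (rule nn_integral_FTC_atLeast)
    show "((\<lambda>y. - (y powr (- a))) has_real_derivative a * y powr (- a - 1)) (at y)" if "s \<le> y" for y
      using that assms by (auto intro!: derivative_eq_intros)
    show "((\<lambda>y. - (y powr (- a))) \<longlongrightarrow> 0) at_top"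
      using tendsto_minus[OF tendsto_neg_powr[of "-a" "\<lambda>x. x" at_top]] assms
      by (simp add: filterlim_ident)
  qed (use assms in auto)
  finally show ?thesis by simp
qed

lemma pred_greaterThan_pair [measurable]:
  "Measurable.pred (borel \<Otimes>\<^sub>M borel) (\<lambda>x::real \<times> real. snd x \<in> {fst x<..})"
  "Measurable.pred (borel \<Otimes>\<^sub>M borel) (\<lambda>x::real \<times> real. fst x \<in> {snd x<..})"
  unfolding greaterThan_iff by measurable

text \<open>Integration by parts carried out by Tonelli: \<open>t powr (- 1 - r)\<close> is the
  integral of \<open>(1 + r) * y powr (- 2 - r)\<close> over \<open>y > t\<close>. After the
  exchange, \<open>K\<close> bounds the integral of \<open>B\<close> over \<open>t < y\<close>, and
  a multiple of the integral of \<open>y powr (- 2)\<close> over \<open>y > s\<close>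
  remains.\<close>

lemma nn_integral_tail_le:
  fixes B :: "real \<Rightarrow> ennreal"
  assumes [measurable]: "B \<in> borel_measurable borel"
    and K: "\<And>x. 0 < x \<Longrightarrow> (\<integral>\<^sup>+t\<in>{0<..<x}. B t \<partial>lborel) \<le> ennreal (K * x powr r)"
    and "0 \<le> K" "0 < r" "0 < s"
  shows "(\<integral>\<^sup>+t\<in>{s<..}. B t * ennreal (t powr (- 1 - r)) \<partial>lborel) \<le> ennreal ((1 + r) * K / s)"
proof -
  let ?c = "\<lambda>y. ennreal ((1 + r) * y powr (- (1 + r) - 1))"
  have "(\<integral>\<^sup>+t\<in>{s<..}. B t * ennreal (t powr (- 1 - r)) \<partial>lborel)
      = (\<integral>\<^sup>+t. \<integral>\<^sup>+y. B t * ?c y * indicator {s<..} t * indicator {t<..} y \<partial>lborel \<partial>lborel)"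
  proof (intro nn_integral_cong)
    fix t :: real
    show "B t * ennreal (t powr (- 1 - r)) * indicator {s<..} t
      = (\<integral>\<^sup>+y. B t * ?c y * indicator {s<..} t * indicator {t<..} y \<partial>lborel)"
    proof (cases "t > s")
      case True
      then have "(\<integral>\<^sup>+y. B t * ?c y * indicator {s<..} t * indicator {t<..} y \<partial>lborel)
          = B t * (\<integral>\<^sup>+y. ?c y * indicator {t<..} y \<partial>lborel)"
        by (subst nn_integral_cmult[symmetric]) (auto simp: mult.assoc)
      with True nn_integral_powr_tail[of "1 + r" t] assms show ?thesis
        by (simp add: algebra_simps)
    qed simp
  qed
  also have "\<dots> = (\<integral>\<^sup>+y. \<integral>\<^sup>+t. B t * ?c y * indicator {s<..} t * indicator {t<..} y \<partial>lborel \<partial>lborel)"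
    by (rule lborel_pair.Fubini'[symmetric]) measurable
  also have "\<dots> \<le> (\<integral>\<^sup>+y\<in>{s<..}. ennreal ((1 + r) * K) * ennreal (1 * y powr (- 1 - 1)) \<partial>lborel)"
  proof (intro nn_integral_mono)
    fix y :: real
    show "(\<integral>\<^sup>+t. B t * ?c y * indicator {s<..} t * indicator {t<..} y \<partial>lborel)
      \<le> ennreal ((1 + r) * K) * ennreal (1 * y powr (- 1 - 1)) * indicator {s<..} y"
    proof (cases "y > s")
      case True
      have "(\<integral>\<^sup>+t. B t * ?c y * indicator {s<..} t * indicator {t<..} y \<partial>lborel)
        \<le> (\<integral>\<^sup>+t. ?c y * (B t * indicator {0<..<y} t) \<partial>lborel)"
        using assms by (intro nn_integral_mono) (auto split: split_indicator simp: mult.commute)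
      also have "\<dots> = ?c y * (\<integral>\<^sup>+t\<in>{0<..<y}. B t \<partial>lborel)"
        by (rule nn_integral_cmult) measurable
      also have "\<dots> \<le> ?c y * ennreal (K * y powr r)"
        using True assms by (intro mult_left_mono K) auto
      also have "\<dots> = ennreal ((1 + r) * K) * ennreal (1 * y powr (- 1 - 1))"
        using True assms by (simp add: ennreal_mult'[symmetric] powr_add[symmetric] mult_ac)
      finally show ?thesis using True by simp
    next
      case False
      then have "(\<integral>\<^sup>+t. B t * ?c y * indicator {s<..} t * indicator {t<..} y \<partial>lborel) = (\<integral>\<^sup>+t. 0 \<partial>(lborel :: real measure))"
        by (intro nn_integral_cong) (auto split: split_indicator)
      then show ?thesis by simp
    qed
  qed
  also have "\<dots> = (\<integral>\<^sup>+y. ennreal ((1 + r) * K) * (ennreal (1 * y powr (- 1 - 1)) * indicator {s<..} y) \<partial>lborel)"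
    by (simp add: mult.assoc)
  also have "\<dots> = ennreal ((1 + r) * K) * ennreal (s powr (- 1))"
    using nn_integral_powr_tail[of 1 s] assms by (subst nn_integral_cmult) auto
  also have "\<dots> = ennreal ((1 + r) * K / s)"
    using assms by (simp add: ennreal_mult'[symmetric] powr_minus divide_inverse)
  finally show ?thesis .
qed

lemma integral_ln_Ioo:
  assumes "0 < (t::real)"
  shows "set_integrable lborel {0<..<t} ln" and "(LBINT s:{0<..<t}. ln s) = t * ln t - t"
proof -
  \<comment> \<open>This difference is non-negative on the interval, so absolute integrability
    follows from the existence of the gauge integral.\<close>
  let ?f = "\<lambda>s. ln t - ln s"
  let ?F = "\<lambda>s. s * ln t - (s * ln s - s)"
  have lim: "((\<lambda>s::real. s * ln s) \<longlongrightarrow> 0) (at_right 0)"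
  proof -
    have "((\<lambda>s::real. - (ln (inverse s) / inverse s)) \<longlongrightarrow> - 0) (at_right 0)"
      by (intro tendsto_minus filterlim_compose[OF ln_x_over_x_tendsto_0] filterlim_inverse_at_top_right)
    moreover have "\<forall>\<^sub>F s::real in at_right 0. - (ln (inverse s) / inverse s) = s * ln s"
      using eventually_at_right_less[of "0::real"]
      by eventually_elim (simp add: ln_inverse divide_inverse)
    ultimately show ?thesis
      using Lim_transform_eventually by fastforce
  qed
  \<comment> \<open>The product takes the value 0 at \<open>s = 0\<close>, which is also its limit
    from the right; hence the primitive is continuous up to the left endpoint.\<close>
  have cont: "continuous_on {0..t} (\<lambda>s. s * ln s)"
  proof (intro continuous_on_eq_continuous_within[THEN iffD2] ballI)
    fix s assume s: "s \<in> {0..t}"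
    show "continuous (at s within {0..t}) (\<lambda>s. s * ln s)"
    proof (cases "s = 0")
      case True
      with lim assms show ?thesis
        by (simp add: continuous_within at_within_Icc_at_right)
    qed (auto intro!: continuous_intros)
  qed
  have "(?f has_integral (?F t - ?F 0)) {0..t}"
    using assms
    by (intro fundamental_theorem_of_calculus_interior continuous_intros cont)
       (auto intro!: derivative_eq_intros simp: has_real_derivative_iff_has_vector_derivative[symmetric])
  then have "(?f has_integral t) {0<..<t}"
    using has_integral_open_interval[of ?f t 0 t] by simp
  moreover have "?f absolutely_integrable_on {0<..<t}"
    using calculation by (intro nonnegative_absolutely_integrable_1) auto
  ultimately have f: "set_integrable lborel {0<..<t} ?f" "(LBINT s:{0<..<t}. ?f s) = t"
    using set_borel_integral_eq_integral(2)[of "{0<..<t}" ?f]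
    by (auto simp: set_integrable_def integrable_completion integral_unique)
  have const: "set_integrable lborel {0<..<t} (\<lambda>s. ln t)" "(LBINT s:{0<..<t}. ln t) = t * ln t"
    using assms by (auto simp: set_integrable_def set_lebesgue_integral_def)
  show "set_integrable lborel {0<..<t} ln"
    using set_integral_diff(1)[OF const(1) f(1)] by simp
  show "(LBINT s:{0<..<t}. ln s) = t * ln t - t"
    using set_integral_diff(2)[OF const(1) f(1)] const f by simp
qed

text \<open>
  Jensen's inequality for \<open>s * h s\<close>: the weight \<open>s\<close> is what makes the operator on the right-hand
  side bounded on \<open>L\<^sup>1\<close>.
\<close>

lemma geometric_mean_le_weighted_mean:
  fixes h :: "real \<Rightarrow> real" and t :: real
  assumes [measurable]: "h \<in> borel_measurable borel"
    and h: "\<And>s. 0 < s \<Longrightarrow> 0 < h s" and "0 < t"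
    and int_ln: "set_integrable lborel {0<..<t} (\<lambda>s. ln (h s))"
    and int: "set_integrable lborel {0<..<t} (\<lambda>s. s * h s)"
  shows "exp (1 / t * (LBINT s:{0<..<t}. ln (h s))) \<le> exp 1 * (LBINT s:{0<..<t}. s * h s) / t\<^sup>2"
proof -
  define S where "S = (LBINT s:{0<..<t}. s * h s)"
  have const: "set_integrable lborel {0<..<t} (\<lambda>s. c)" "(LBINT s:{0<..<t}. c) = c * t" for c :: real
    using \<open>0 < t\<close> by (auto simp add: set_integrable_def set_lebesgue_integral_def)
  have "S > 0"
    unfolding S_def using h by (intro set_integral_pos \<open>0 < t\<close> int) auto
  \<comment> \<open>\<open>c\<close> is the mean of \<open>s * h s\<close>. Integrating the tangent
    bound for \<open>ln\<close> at this point gives Jensen's inequality.\<close>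
  define c where "c = S / t"
  have "c > 0" using \<open>S > 0\<close> \<open>0 < t\<close> by (simp add: c_def)
  have i1: "set_integrable lborel {0<..<t} (\<lambda>s. s * h s / c)"
    using int by simp
  have i2: "set_integrable lborel {0<..<t} (\<lambda>s. s * h s / c + (ln c - 1))"
    by (rule set_integral_add(1)[OF i1 const(1)])
  have "(LBINT s:{0<..<t}. ln (h s)) \<le> (LBINT s:{0<..<t}. s * h s / c + (ln c - 1) - ln s)"
  proof (rule set_integral_mono[OF int_ln])
    show "set_integrable lborel {0<..<t} (\<lambda>s. s * h s / c + (ln c - 1) - ln s)"
      by (rule set_integral_diff(1)[OF i2 integral_ln_Ioo(1)[OF \<open>0 < t\<close>]])
    fix s assume "s \<in> {0<..<t}"
    then have "ln (s * h s / c) \<le> s * h s / c - 1"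
      using h \<open>c > 0\<close> by (intro ln_le_minus_one) auto
    with \<open>s \<in> _\<close> h[of s] \<open>c > 0\<close> show "ln (h s) \<le> s * h s / c + (ln c - 1) - ln s"
      by (simp add: ln_mult ln_div)
  qed
  \<comment> \<open>Since \<open>S / c = t\<close>, the first term cancels the \<open>- t\<close> of
    the second. The remaining \<open>t\<close>, responsible for the factor \<open>exp 1\<close>,
    comes from the integral of \<open>ln s\<close>.\<close>
  also have "\<dots> = S / c + (ln c - 1) * t - (t * ln t - t)"
    unfolding set_integral_diff(2)[OF i2 integral_ln_Ioo(1)[OF \<open>0 < t\<close>]]
      set_integral_add(2)[OF i1 const(1)] const(2) integral_ln_Ioo(2)[OF \<open>0 < t\<close>]
    by (simp add: S_def)
  also have "\<dots> = t * (1 + ln S - 2 * ln t)"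
    using \<open>S > 0\<close> \<open>0 < t\<close> by (simp add: c_def ln_div) (simp add: algebra_simps)
  finally have "1 / t * (LBINT s:{0<..<t}. ln (h s)) \<le> 1 + ln S - 2 * ln t"
    using \<open>0 < t\<close> by (simp add: field_simps)
  then have "exp (1 / t * (LBINT s:{0<..<t}. ln (h s))) \<le> exp (1 + ln S - 2 * ln t)"
    by simp
  also have "\<dots> = exp 1 * S / t\<^sup>2"
    using \<open>S > 0\<close> \<open>0 < t\<close> by (simp add: exp_diff exp_add exp_double)
  finally show ?thesis by (simp add: S_def)
qed

theorem geometric_mean_weighted_inequality:
  fixes B :: "real \<Rightarrow> ennreal" and h :: "real \<Rightarrow> real"
  assumes [measurable]: "B \<in> borel_measurable borel" "h \<in> borel_measurable borel"
    and K: "\<And>x. 0 < x \<Longrightarrow> (\<integral>\<^sup>+t\<in>{0<..<x}. B t \<partial>lborel) \<le> ennreal (K * x powr r)"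
    and "0 \<le> K" "1 \<le> r"
    and h: "\<And>s. 0 < s \<Longrightarrow> 0 < h s"
    and H: "(\<integral>\<^sup>+s\<in>{0<..}. ennreal (h s) \<partial>lborel) = ennreal H" "0 < H"
    and int_ln: "\<And>t. 0 < t \<Longrightarrow> set_integrable lborel {0<..<t} (\<lambda>s. ln (h s))"
  shows "(\<integral>\<^sup>+t\<in>{0<..}. B t * ennreal (exp (1 / t * (LBINT s:{0<..<t}. ln (h s))) powr r) \<partial>lborel)
    \<le> ennreal ((1 + r) * K * exp r * H powr r)"
proof -
  \<comment> \<open>\<open>exp r\<close> is the \<open>r\<close>-th power of the factor
    \<open>exp 1\<close> in the pointwise bound; \<open>H powr (r - 1)\<close> comes from the
    \<open>r - 1\<close> powers of \<open>S\<close> that are estimated by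
    \<open>t * H\<close>.\<close>
  define D where "D = exp r * H powr (r - 1)"
  have pointwise: "ennreal (exp (1 / t * (LBINT s:{0<..<t}. ln (h s))) powr r)
      \<le> ennreal D * ennreal (t powr (- 1 - r)) * (\<integral>\<^sup>+s\<in>{0<..<t}. ennreal (s * h s) \<partial>lborel)" if "0 < t" for t
  proof -
    define S where "S = (LBINT s:{0<..<t}. s * h s)"
    have "(\<integral>\<^sup>+s\<in>{0<..<t}. ennreal (s * h s) \<partial>lborel) \<le> (\<integral>\<^sup>+s. ennreal t * (ennreal (h s) * indicator {0<..} s) \<partial>lborel)"
      using h by (intro nn_integral_mono)
        (auto split: split_indicator simp: ennreal_mult'[symmetric] less_imp_le intro!: ennreal_leI mult_right_mono)
    also have "\<dots> = ennreal (t * H)"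
      using H \<open>0 < t\<close> by (subst nn_integral_cmult) (auto simp: ennreal_mult')
    finally have le: "(\<integral>\<^sup>+s\<in>{0<..<t}. ennreal (s * h s) \<partial>lborel) \<le> ennreal (t * H)" .
    have eq: "(\<integral>\<^sup>+s\<in>{0<..<t}. ennreal (s * h s) \<partial>lborel) = (\<integral>\<^sup>+s. ennreal (indicator {0<..<t} s *\<^sub>R (s * h s)) \<partial>lborel)"
      by (intro nn_integral_cong) (auto split: split_indicator)
    have nonneg: "AE s in lborel. 0 \<le> indicator {0<..<t} s *\<^sub>R (s * h s)"
      using h by (intro AE_I2) (auto split: split_indicator intro: less_imp_le)
    have int: "set_integrable lborel {0<..<t} (\<lambda>s. s * h s)"
      unfolding set_integrable_def
      by (rule integrableI_nonneg[OF _ nonneg]) (use le eq in \<open>auto simp: top.extremum_strict less_top[symmetric] top_unique\<close>)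
    have S: "(\<integral>\<^sup>+s\<in>{0<..<t}. ennreal (s * h s) \<partial>lborel) = ennreal S"
      unfolding eq S_def set_lebesgue_integral_def
      by (rule nn_integral_eq_integral[OF int[unfolded set_integrable_def] nonneg])
    have "0 \<le> S"
      unfolding S_def set_lebesgue_integral_def by (rule integral_nonneg_AE[OF nonneg])
    have "S \<le> t * H"
      using le \<open>0 < t\<close> \<open>0 < H\<close> unfolding S by (simp add: ennreal_le_iff)
    have "exp (1 / t * (LBINT s:{0<..<t}. ln (h s))) powr r \<le> (exp 1 * S / t\<^sup>2) powr r"
      unfolding S_def using \<open>1 \<le> r\<close> \<open>0 < t\<close>
      by (intro powr_mono2 geometric_mean_le_weighted_mean int_ln int h) auto
    also have "\<dots> = exp r * (S powr (r - 1) * S powr 1) * t powr (- 2 * r)"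
    proof -
      have "S powr r = S powr (r - 1) * S powr 1"
        using powr_add[of S "r - 1" 1] by simp
      moreover have "t\<^sup>2 powr r = t powr (2 * r)"
        using \<open>0 < t\<close> powr_powr[of t 2 r] by simp
      ultimately show ?thesis
        by (simp add: powr_mult powr_divide exp_powr_real powr_minus_divide)
    qed
    \<comment> \<open>Sacrificing all but one power of \<open>S\<close> makes the bound linear in \<open>h\<close>, so that Tonelli applies.\<close>
    also have "\<dots> \<le> exp r * ((t * H) powr (r - 1) * S powr 1) * t powr (- 2 * r)"
      using \<open>0 \<le> S\<close> \<open>S \<le> t * H\<close> \<open>1 \<le> r\<close> by (intro mult_right_mono mult_left_mono powr_mono2) auto
    also have "\<dots> = D * (t powr (r - 1) * t powr (- 2 * r)) * S"
      using \<open>0 \<le> S\<close> \<open>0 < t\<close> \<open>0 < H\<close> by (simp add: D_def powr_mult)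
    also have "t powr (r - 1) * t powr (- 2 * r) = t powr (- 1 - r)"
      unfolding powr_add[symmetric] by (rule arg_cong[where f = "\<lambda>a. t powr a"]) simp
    finally show ?thesis
      using \<open>0 \<le> S\<close> by (simp add: S ennreal_mult'[symmetric] ennreal_mult''[symmetric] D_def ennreal_leI)
  qed
  have "(\<integral>\<^sup>+t\<in>{0<..}. B t * ennreal (exp (1 / t * (LBINT s:{0<..<t}. ln (h s))) powr r) \<partial>lborel)
      \<le> (\<integral>\<^sup>+t. B t * (ennreal D * ennreal (t powr (- 1 - r)) * (\<integral>\<^sup>+s\<in>{0<..<t}. ennreal (s * h s) \<partial>lborel)) * indicator {0<..} t \<partial>lborel)"
  proof (intro nn_integral_mono)
    show "B t * ennreal (exp (1 / t * (LBINT s:{0<..<t}. ln (h s))) powr r) * indicator {0<..} t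
      \<le> B t * (ennreal D * ennreal (t powr (- 1 - r)) * (\<integral>\<^sup>+s\<in>{0<..<t}. ennreal (s * h s) \<partial>lborel)) * indicator {0<..} t" for t
      using mult_left_mono[OF pointwise[of t], of "B t"] by (cases "0 < t") simp_all
  qed
  also have "\<dots> = (\<integral>\<^sup>+t. \<integral>\<^sup>+s. ennreal D * (B t * ennreal (t powr (- 1 - r)) * ennreal (s * h s) * indicator {0<..} s * indicator {s<..} t) \<partial>lborel \<partial>lborel)"
  proof (intro nn_integral_cong)
    fix t :: real
    show "B t * (ennreal D * ennreal (t powr (- 1 - r)) * (\<integral>\<^sup>+s\<in>{0<..<t}. ennreal (s * h s) \<partial>lborel)) * indicator {0<..} t
      = (\<integral>\<^sup>+s. ennreal D * (B t * ennreal (t powr (- 1 - r)) * ennreal (s * h s) * indicator {0<..} s * indicator {s<..} t) \<partial>lborel)"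
      (is "?l = ?r")
    proof -
      have "?r = (\<integral>\<^sup>+s. B t * ennreal D * ennreal (t powr (- 1 - r)) * indicator {0<..} t * (ennreal (s * h s) * indicator {0<..<t} s) \<partial>lborel)"
        by (intro nn_integral_cong) (auto split: split_indicator simp: mult_ac)
      also have "\<dots> = ?l"
        by (subst nn_integral_cmult) (auto simp: mult_ac)
      finally show ?thesis by simp
    qed
  qed
  also have "\<dots> = (\<integral>\<^sup>+s. \<integral>\<^sup>+t. ennreal D * (B t * ennreal (t powr (- 1 - r)) * ennreal (s * h s) * indicator {0<..} s * indicator {s<..} t) \<partial>lborel \<partial>lborel)"
    by (rule lborel_pair.Fubini'[symmetric]) measurable
  also have "\<dots> \<le> (\<integral>\<^sup>+s. ennreal (D * ((1 + r) * K)) * (ennreal (h s) * indicator {0<..} s) \<partial>lborel)"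
  proof (intro nn_integral_mono)
    fix s :: real
    show "(\<integral>\<^sup>+t. ennreal D * (B t * ennreal (t powr (- 1 - r)) * ennreal (s * h s) * indicator {0<..} s * indicator {s<..} t) \<partial>lborel)
      \<le> ennreal (D * ((1 + r) * K)) * (ennreal (h s) * indicator {0<..} s)" (is "?l \<le> ?r")
    proof (cases "0 < s")
      case True
      have "?l = (\<integral>\<^sup>+t. ennreal D * ennreal (s * h s) * (B t * ennreal (t powr (- 1 - r)) * indicator {s<..} t) \<partial>lborel)"
        using True by (intro nn_integral_cong) (simp add: mult_ac)
      also have "\<dots> = ennreal D * ennreal (s * h s) * (\<integral>\<^sup>+t\<in>{s<..}. B t * ennreal (t powr (- 1 - r)) \<partial>lborel)"
        by (rule nn_integral_cmult) measurable
      \<comment> \<open>The weight \<open>s\<close> cancels the \<open>1 / s\<close> of the tail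
        estimate, leaving a constant multiple of \<open>h s\<close>.\<close>
      also have "\<dots> \<le> ennreal D * ennreal (s * h s) * ennreal ((1 + r) * K / s)"
        using True assms by (intro mult_left_mono nn_integral_tail_le) auto
      also have "\<dots> = ?r"
        using True h[of s] assms by (simp add: ennreal_mult'[symmetric] ennreal_mult''[symmetric] D_def mult_ac)
      finally show ?thesis .
    qed simp
  qed
  also have "\<dots> = ennreal (D * ((1 + r) * K)) * ennreal H"
    using H by (subst nn_integral_cmult) auto
  also have "\<dots> = ennreal ((1 + r) * K * exp r * H powr r)"
    using \<open>0 < H\<close> assms powr_add[of H "r - 1" 1] by (simp add: ennreal_mult'[symmetric] ennreal_mult''[symmetric] D_def mult_ac)
  finally show ?thesis .
qed

subsection \<open>Generalized means\<close>

lemma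
  fixes f f' :: "real \<Rightarrow> real"
  assumes [measurable]: "f' \<in> borel_measurable borel"
    and eq: "AE s in lborel. 0 < s \<longrightarrow> f s = f' s"
  shows set_integrable_lebesgue_eq_lborel:
      "set_integrable lebesgue {0<..<x} f \<longleftrightarrow> set_integrable lborel {0<..<x} f'" (is ?thesis1)
    and set_integral_lebesgue_eq_lborel:
      "(LINT s:{0<..<x}|lebesgue. f s) = (LBINT s:{0<..<x}. f' s)" (is ?thesis2)
proof -
  let ?k = "\<lambda>s. indicator {0<..<x} s *\<^sub>R f s" and ?k' = "\<lambda>s. indicator {0<..<x} s *\<^sub>R f' s"
  have ae: "AE s in lborel. ?k s = ?k' s"
    using eq by eventually_elim (auto split: split_indicator)
  have k' [measurable]: "?k' \<in> borel_measurable lborel" "?k' \<in> borel_measurable lebesgue"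
    by (simp, intro measurable_completion, simp)
  \<comment> \<open>Measurability of \<open>f\<close> is obtained rather than assumed:
    \<open>f\<close> agrees almost everywhere with a Borel function, and the completed measure
    contains every subset of a null set.\<close>
  have k [measurable]: "?k \<in> borel_measurable lebesgue"
  proof (rule borel_measurableI_le)
    fix a
    have [measurable]: "Measurable.pred lebesgue (\<lambda>s. ?k s \<noteq> ?k' s)"
      "Measurable.pred lebesgue (\<lambda>s. ?k s \<noteq> ?k' s \<and> ?k s \<le> a)"
      using ae by (intro sets_completion_AE; eventually_elim; simp)+
    have "{s \<in> space lebesgue. ?k s \<le> a}
        = {s \<in> space lebesgue. (?k' s \<le> a \<and> \<not> ?k s \<noteq> ?k' s) \<or> (?k s \<noteq> ?k' s \<and> ?k s \<le> a)}"
      by auto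
    also have "\<dots> \<in> sets lebesgue"
      by measurable
    finally show "{s \<in> space lebesgue. ?k s \<le> a} \<in> sets lebesgue" .
  qed
  show ?thesis1
    unfolding set_integrable_def
    using integrable_cong_AE[OF k k'(2) AE_completion[OF ae]] integrable_completion[OF k'(1)] by simp
  show ?thesis2
    unfolding set_lebesgue_integral_def
    using integral_cong_AE[OF k k'(2) AE_completion[OF ae]] integral_completion[OF k'(1)] by simp
qed

lemma nn_integral_lebesgue_eq_lborel:
  assumes "AE s in lborel. s \<in> A \<longrightarrow> f s = f' s"
  shows "(\<integral>\<^sup>+s\<in>A. f s \<partial>lebesgue) = (\<integral>\<^sup>+s\<in>A. f' s \<partial>lborel)"
  unfolding nn_integral_completion
  by (rule nn_integral_cong_AE) (use assms in \<open>auto elim!: eventually_mono split: split_indicator\<close>)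

lemma positive_borel_representative:
  assumes "set_borel_measurable lebesgue {0<..} f" and pos: "\<And>x. 0 < x \<Longrightarrow> 0 < f x"
  obtains f' :: "real \<Rightarrow> real" where "f' \<in> borel_measurable borel" "\<And>x. 0 < f' x"
    "AE x in lborel. 0 < x \<longrightarrow> f x = f' x"
proof -
  obtain k where [measurable]: "k \<in> borel_measurable lborel"
      and k: "AE x in lborel. indicator {0<..} x *\<^sub>R f x = k x"
    using completion_ex_borel_measurable_real assms(1) unfolding set_borel_measurable_def by blast
  show thesis
  proof
    \<comment> \<open>The value 1 makes the representative positive on the whole line; on the
      half-line it occurs only on a null set, because \<open>f\<close> is positive there.\<close>
    show "(\<lambda>x. if 0 < k x then k x else 1) \<in> borel_measurable borel"
      by measurable
    show "AE x in lborel. 0 < x \<longrightarrow> f x = (if 0 < k x then k x else 1)"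
      using k by eventually_elim (auto split: split_indicator_asm dest: pos)
  qed auto
qed

text \<open>The second derivative of \<open>ln (\<phi> x)\<close> is
  \<open>(\<phi> * \<phi>'' - \<phi>'^2) / \<phi>^2\<close>, non-negative by the class condition,
  and a convex function lies above its tangents.\<close>

lemma class_Phi_tangent:
  fixes \<phi> :: "real \<Rightarrow> real"
  assumes \<Phi>: "class_Phi S \<phi>" and m: "m \<in> S"
  obtains \<beta> where "\<And>y. y \<in> S \<Longrightarrow> ln (\<phi> m) + \<beta> * (y - m) \<le> ln (\<phi> y)"
proof -
  obtain a b where S: "S = einterval a b" and pos: "\<And>x. x \<in> S \<Longrightarrow> 0 < \<phi> x"
    and d1: "\<phi> differentiable_on S" and d2: "deriv \<phi> differentiable_on S"
    and ineq: "\<And>x. x \<in> S \<Longrightarrow> (deriv \<phi> x)\<^sup>2 \<le> \<phi> x * deriv (deriv \<phi>) x"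
    using \<Phi> unfolding class_Phi_def by blast
  have "open S" by (simp add: S)
  have "convex S"
    unfolding S is_interval_convex_1[symmetric] is_interval_1 einterval_def
    by (auto; meson ereal_less_eq(3) order.strict_trans1 order.strict_trans2)
  have D: "(f has_real_derivative deriv f x) (at x)" if "f differentiable_on S" "x \<in> S" for f :: "real \<Rightarrow> real" and x
    using that \<open>open S\<close> by (simp add: differentiable_on_eq_differentiable_at DERIV_deriv_iff_real_differentiable)
  note D1 = D[OF d1] and D2 = D[OF d2]
  have ln1: "((\<lambda>x. ln (\<phi> x)) has_real_derivative deriv \<phi> x / \<phi> x) (at x)" if "x \<in> S" for x
    using D1[OF that] pos[OF that] by (auto intro!: derivative_eq_intros)
  have "convex_on S (\<lambda>x. ln (\<phi> x))"
  proof (rule f''_ge0_imp_convex[OF \<open>convex S\<close> ln1])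
    show "((\<lambda>x. deriv \<phi> x / \<phi> x) has_real_derivative
        (deriv (deriv \<phi>) x * \<phi> x - deriv \<phi> x * deriv \<phi> x) / (\<phi> x * \<phi> x)) (at x)" if "x \<in> S" for x
      using D1[OF that] D2[OF that] pos[OF that] by (auto intro!: derivative_eq_intros)
    show "0 \<le> (deriv (deriv \<phi>) x * \<phi> x - deriv \<phi> x * deriv \<phi> x) / (\<phi> x * \<phi> x)" if "x \<in> S" for x
      using ineq[OF that] pos[OF that] by (simp add: power2_eq_square mult.commute)
  qed
  then have "deriv \<phi> m / \<phi> m * (y - m) \<le> ln (\<phi> y) - ln (\<phi> m)" if "y \<in> S" for y
  proof (rule convex_on_imp_above_tangent[OF _ convex_connected[OF \<open>convex S\<close>] _ that])
    show "((\<lambda>x. ln (\<phi> x)) has_real_derivative deriv \<phi> m / \<phi> m) (at m within S)"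
      using ln1[OF m] by (rule has_field_derivative_at_within)
  qed (use m \<open>open S\<close> in \<open>auto simp: interior_open\<close>)
  then show thesis
    by (intro that[of "deriv \<phi> m / \<phi> m"]) (simp add: algebra_simps)
qed

text \<open>Strict bounds on \<open>k\<close> stay strict after integration over an interval of
  positive length. The mean thus lies in the open interval, where a tangent can be taken.\<close>

lemma mean_in_einterval:
  fixes k :: "real \<Rightarrow> real" and a b :: ereal
  assumes "0 \<le> a" "0 < t" and int: "set_integrable lborel {0<..<t} k"
    and k: "\<And>s. 0 < s \<Longrightarrow> k s \<in> einterval a b"
  shows "1 / t * (LBINT s:{0<..<t}. k s) \<in> einterval a b"
proof -
  have const: "set_integrable lborel {0<..<t} (\<lambda>s. c)" "(LBINT s:{0<..<t}. c) = c * t" for c :: real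
    using \<open>0 < t\<close> by (auto simp: set_integrable_def set_lebesgue_integral_def)
  have "a < ereal (1 / t * (LBINT s:{0<..<t}. k s))"
  proof (cases a)
    case (real a')
    have "0 < (LBINT s:{0<..<t}. k s - a')"
      using k real by (intro set_integral_pos \<open>0 < t\<close> set_integral_diff(1)[OF int const(1)]) (auto simp: einterval_def)
    then have "a' * t < (LBINT s:{0<..<t}. k s)"
      unfolding set_integral_diff(2)[OF int const(1)] const(2) by simp
    then show ?thesis using \<open>0 < t\<close> real by (simp add: field_simps)
  \<comment> \<open>Both infinite values of \<open>a\<close> are impossible: the negative one by
    \<open>0 \<le> a\<close>, the positive one because \<open>k 1\<close> lies in the
    interval.\<close>
  qed (use \<open>0 \<le> a\<close> k[of 1] in \<open>auto simp: einterval_def\<close>)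
  moreover have "ereal (1 / t * (LBINT s:{0<..<t}. k s)) < b"
  proof (cases b)
    case (real b')
    have "0 < (LBINT s:{0<..<t}. b' - k s)"
      using k real by (intro set_integral_pos \<open>0 < t\<close> set_integral_diff(1)[OF const(1) int]) (auto simp: einterval_def)
    then have "(LBINT s:{0<..<t}. k s) < b' * t"
      unfolding set_integral_diff(2)[OF const(1) int] const(2) by simp
    then show ?thesis using \<open>0 < t\<close> real by (simp add: field_simps)
  qed (use k[of 1] in \<open>auto simp: einterval_def\<close>)
  ultimately show ?thesis by (simp add: einterval_def)
qed

text \<open>The geometric mean of \<open>V * F powr p\<close> is that of \<open>V\<close> times the
  \<open>p\<close>-th power of that of \<open>F\<close>, so \<open>V\<close> cancels against the
  mean of \<open>1 / V\<close> in the weight. The minorants in \<open>lower\<close>, later supplied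
  by tangent lines, provide the lower half of the integrability of \<open>ln F\<close>.\<close>

lemma
  fixes F U V :: "real \<Rightarrow> real"
  assumes [measurable]: "F \<in> borel_measurable borel" "U \<in> borel_measurable borel" "V \<in> borel_measurable borel"
    and F: "\<And>s. 0 < s \<Longrightarrow> 0 < F s" and U: "\<And>s. 0 < s \<Longrightarrow> 0 < U s" and V: "\<And>s. 0 < s \<Longrightarrow> 0 < V s"
    and "0 < p" "p \<le> q" "0 \<le> K"
    and int_V: "\<And>t. 0 < t \<Longrightarrow> set_integrable lborel {0<..<t} (\<lambda>s. ln (V s))"
    and K: "\<And>x. 0 < x \<Longrightarrow> (\<integral>\<^sup>+t\<in>{0<..<x}. ennreal (U t * exp (1 / t * (LBINT s:{0<..<t}. - ln (V s))) powr (q / p)) \<partial>lborel)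
        \<le> ennreal (K * x powr (q / p))"
    and H: "(\<integral>\<^sup>+s\<in>{0<..}. ennreal (V s * F s powr p) \<partial>lborel) = ennreal H"
    and lower: "\<And>t. 0 < t \<Longrightarrow> \<exists>l. set_integrable lborel {0<..<t} l \<and> (\<forall>s. 0 < s \<longrightarrow> l s \<le> ln (F s))"
  shows set_integrable_ln_of_lower_bound: "\<And>t. 0 < t \<Longrightarrow> set_integrable lborel {0<..<t} (\<lambda>s. ln (F s))"
    and exp_mean_ln_inequality:
      "(\<integral>\<^sup>+t\<in>{0<..}. ennreal (U t * exp (1 / t * (LBINT s:{0<..<t}. ln (F s))) powr q) \<partial>lborel)
        \<le> ennreal ((1 + q / p) * K * exp (q / p) * H powr (q / p))"
proof -
  define h where "h s = V s * F s powr p" for s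
  have [measurable]: "h \<in> borel_measurable borel"
    unfolding h_def[abs_def] by measurable
  have h: "0 < h s" if "0 < s" for s
    using F[OF that] V[OF that] by (simp add: h_def)
  have ln_h: "ln (h s) = ln (V s) + p * ln (F s)" if "0 < s" for s
    using F[OF that] V[OF that] by (simp add: h_def ln_mult ln_powr)
  have int_h: "set_integrable lborel {0<..<t} h" for t
    unfolding set_integrable_def
  proof (rule integrableI_nonneg)
    show "AE s in lborel. 0 \<le> indicator {0<..<t} s *\<^sub>R h s"
      using h by (intro AE_I2) (auto split: split_indicator simp: less_imp_le)
    have "(\<integral>\<^sup>+s. ennreal (indicator {0<..<t} s *\<^sub>R h s) \<partial>lborel) \<le> (\<integral>\<^sup>+s\<in>{0<..}. ennreal (V s * F s powr p) \<partial>lborel)"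
      by (intro nn_integral_mono) (auto split: split_indicator simp: h_def)
    then show "(\<integral>\<^sup>+s. ennreal (indicator {0<..<t} s *\<^sub>R h s) \<partial>lborel) < \<infinity>"
      unfolding H by (simp add: order.strict_trans1)
  qed measurable
  show int_F: "set_integrable lborel {0<..<t} (\<lambda>s. ln (F s))" if "0 < t" for t
  proof -
    obtain l where int_low: "set_integrable lborel {0<..<t} l" and l: "\<And>s. 0 < s \<Longrightarrow> l s \<le> ln (F s)"
      using lower[OF \<open>0 < t\<close>] by blast
    have upper: "ln (F s) \<le> (h s - ln (V s)) / p" if "0 < s" for s
    proof -
      have "ln (h s) \<le> h s"
        using ln_le_minus_one[OF h[OF that]] by linarith
      then show ?thesis
        using \<open>0 < p\<close> ln_h[OF that] by (simp add: field_simps)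
    qed
    have "set_integrable lborel {0<..<t} (\<lambda>s. \<bar>l s\<bar> + \<bar>(h s - ln (V s)) / p\<bar>)"
      using int_low int_h[of t] int_V[OF \<open>0 < t\<close>]
      by (intro set_integral_add(1) set_integrable_abs set_integrable_divide set_integral_diff(1))
    then show ?thesis
    proof (rule set_integrable_bound)
      show "set_borel_measurable lborel {0<..<t} (\<lambda>s. ln (F s))"
        by (simp add: set_borel_measurable_def)
      show "AE s in lborel. s \<in> {0<..<t} \<longrightarrow> norm (ln (F s)) \<le> norm (\<bar>l s\<bar> + \<bar>(h s - ln (V s)) / p\<bar>)"
      proof (intro AE_I2 impI)
        fix s assume "s \<in> {0<..<t}"
        then have "l s \<le> ln (F s)" "ln (F s) \<le> (h s - ln (V s)) / p"
          using upper l by auto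
        then show "norm (ln (F s)) \<le> norm (\<bar>l s\<bar> + \<bar>(h s - ln (V s)) / p\<bar>)"
          unfolding real_norm_def by linarith
      qed
    qed
  qed
  \<comment> \<open>\<open>ennreal H\<close> only records \<open>max 0 H\<close>. The value 0 would
    make \<open>h\<close> vanish almost everywhere, against its positivity.\<close>
  have "0 < H"
  proof (rule ccontr)
    assume "\<not> 0 < H"
    then have "(\<integral>\<^sup>+s\<in>{0<..}. ennreal (h s) \<partial>lborel) = 0"
      using H by (simp add: h_def ennreal_neg)
    then have "AE s in lborel. s \<notin> {0<..<1::real}"
      by (subst (asm) nn_integral_0_iff_AE)
         (use h in \<open>auto elim!: eventually_mono split: split_indicator_asm simp: ennreal_eq_0_iff not_less[symmetric]\<close>)
    then have "emeasure lborel {0<..<1::real} = 0"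
      by (subst (asm) AE_iff_measurable[of "{0<..<1}"]) auto
    then show False by simp
  qed
  have int_lown_h: "set_integrable lborel {0<..<t} (\<lambda>s. ln (h s))"
      "(LBINT s:{0<..<t}. ln (h s)) = (LBINT s:{0<..<t}. ln (V s)) + p * (LBINT s:{0<..<t}. ln (F s))" if "0 < t" for t
  proof -
    have pF: "set_integrable lborel {0<..<t} (\<lambda>s. p * ln (F s))"
      using int_F[OF that] by simp
    have cong: "indicator {0<..<t} s *\<^sub>R ln (h s) = indicator {0<..<t} s *\<^sub>R (ln (V s) + p * ln (F s))" for s
      using ln_h by (auto split: split_indicator)
    show "set_integrable lborel {0<..<t} (\<lambda>s. ln (h s))"
      using set_integral_add(1)[OF int_V[OF that] pF] unfolding set_integrable_def cong .
    show "(LBINT s:{0<..<t}. ln (h s)) = (LBINT s:{0<..<t}. ln (V s)) + p * (LBINT s:{0<..<t}. ln (F s))"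
    proof -
      have "(LBINT s:{0<..<t}. ln (h s)) = (LBINT s:{0<..<t}. ln (V s) + p * ln (F s))"
        unfolding set_lebesgue_integral_def cong ..
      with set_integral_add(2)[OF int_V[OF that] pF] show ?thesis by simp
    qed
  qed
  let ?B = "\<lambda>t. ennreal (U t * exp (1 / t * (LBINT s:{0<..<t}. - ln (V s))) powr (q / p))"
  have "(\<integral>\<^sup>+t\<in>{0<..}. ?B t * ennreal (exp (1 / t * (LBINT s:{0<..<t}. ln (h s))) powr (q / p)) \<partial>lborel)
      \<le> ennreal ((1 + q / p) * K * exp (q / p) * H powr (q / p))"
    using \<open>0 < p\<close> \<open>p \<le> q\<close> \<open>0 \<le> K\<close> \<open>0 < H\<close> H
    by (intro geometric_mean_weighted_inequality K h int_lown_h(1)) (auto simp: h_def)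
  also have "(\<integral>\<^sup>+t\<in>{0<..}. ?B t * ennreal (exp (1 / t * (LBINT s:{0<..<t}. ln (h s))) powr (q / p)) \<partial>lborel)
      = (\<integral>\<^sup>+t\<in>{0<..}. ennreal (U t * exp (1 / t * (LBINT s:{0<..<t}. ln (F s))) powr q) \<partial>lborel)"
  proof (intro nn_integral_cong)
    fix t :: real
    show "?B t * ennreal (exp (1 / t * (LBINT s:{0<..<t}. ln (h s))) powr (q / p)) * indicator {0<..} t
      = ennreal (U t * exp (1 / t * (LBINT s:{0<..<t}. ln (F s))) powr q) * indicator {0<..} t"
    proof (cases "0 < t")
      case True
      have neg: "(LBINT s:{0<..<t}. - ln (V s)) = - (LBINT s:{0<..<t}. ln (V s))"
        by (simp add: set_lebesgue_integral_def)
      \<comment> \<open>In the exponent the two integrals of \<open>ln (V s)\<close> cancel, and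
        \<open>p * (q / p) = q\<close>.\<close>
      have "exp (1 / t * (LBINT s:{0<..<t}. - ln (V s))) powr (q / p) * exp (1 / t * (LBINT s:{0<..<t}. ln (h s))) powr (q / p)
          = exp (1 / t * (LBINT s:{0<..<t}. ln (F s))) powr q"
        unfolding neg int_lown_h(2)[OF True] using \<open>0 < p\<close> True
        by (simp add: exp_powr_real exp_add[symmetric]) (simp add: field_simps)
      then show ?thesis
        using U[OF True] by (simp add: ennreal_mult''[symmetric] mult.assoc)
    qed simp
  qed
  finally show "(\<integral>\<^sup>+t\<in>{0<..}. ennreal (U t * exp (1 / t * (LBINT s:{0<..<t}. ln (F s))) powr q) \<partial>lborel)
        \<le> ennreal ((1 + q / p) * K * exp (q / p) * H powr (q / p))" .
qed

section \<open>Powers of extended non-negative reals, and the final assembly\<close>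

lemma epowr_ennreal: "0 \<le> y \<Longrightarrow> epowr (ennreal y) r = ennreal (y powr r)"
  by (simp add: epowr_def)

lemma epowr_mono: "x \<le> y \<Longrightarrow> 0 \<le> r \<Longrightarrow> epowr x r \<le> epowr y r"
  by (cases x; cases y) (auto simp: epowr_def top_unique intro!: ennreal_leI powr_mono2)

theorem theorem4p3:
  fixes p q :: real and w g u v U V :: "real \<Rightarrow> real"
  assumes "0 < p" and "p \<le> q"
    and "weight w"
    and "\<And>x. x > 0 \<Longrightarrow> set_integrable lebesgue {0<..<x} w"
    and "(\<integral>\<^sup>+ s\<in>{0<..}. ennreal (w s) \<partial>lebesgue) = \<infinity>"
    and "\<And>x. x > 0 \<Longrightarrow> 0 \<le> g x"
    and "continuous_on {0<..} g"
    and "strict_mono_on {0<..} g \<or> strict_antimono_on {0<..} g"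
    and "class_Phi (g ` {0<..}) (the_inv_into {0<..} g)"
    and "weight u" and "weight v"
    and U_def: "U = transport w u"
    and V_def: "V = transport w v"
    and "geo_mean_defined (\<lambda>t. 1 / V t)"
    and "(SUP x\<in>{0<..}. ennreal (x powr (- 1 / p)) *
            epowr (\<integral>\<^sup>+ t\<in>{0<..<x}.
                     ennreal (U t * geo_mean (\<lambda>s. 1 / V s) t powr (q / p)) \<partial>lebesgue) (1 / q)) < \<infinity>"
  shows "\<exists>C::real. 0 < C \<and>
    (\<forall>f :: real \<Rightarrow> real.
       set_borel_measurable lebesgue {0<..} f \<longrightarrow> (\<forall>x>0. 0 < f x) \<longrightarrow> gen_mean_defined g w f \<longrightarrow>
       epowr (\<integral>\<^sup>+ x\<in>{0<..}. ennreal (u x * gen_mean g w f x powr q) \<partial>lebesgue) (1 / q)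
         \<le> ennreal C * epowr (\<integral>\<^sup>+ x\<in>{0<..}. ennreal (v x * f x powr p) \<partial>lebesgue) (1 / p))"
proof -
  define r where "r = q / p"
  have "0 < q" using assms(1,2) by simp

  \<comment> \<open>Borel representatives and the transported weights\<close>
  obtain w0 where w0 [measurable]: "w0 \<in> borel_measurable borel" and w0_pos: "\<And>x. 0 < w0 x"
      and w_eq: "AE x in lborel. 0 < x \<longrightarrow> w x = w0 x"
    using positive_borel_representative[of w] assms(3) unfolding weight_def by blast
  obtain u0 where u0 [measurable]: "u0 \<in> borel_measurable borel" and u0_pos: "\<And>x. 0 < u0 x"
      and u_eq: "AE x in lborel. 0 < x \<longrightarrow> u x = u0 x"
    using positive_borel_representative[of u] \<open>weight u\<close> unfolding weight_def by blast
  obtain v0 where v0 [measurable]: "v0 \<in> borel_measurable borel" and v0_pos: "\<And>x. 0 < v0 x"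
      and v_eq: "AE x in lborel. 0 < x \<longrightarrow> v x = v0 x"
    using positive_borel_representative[of v] \<open>weight v\<close> unfolding weight_def by blast
  interpret time_change w0
  proof
    show "set_integrable lborel {0<..<x} w0" if "0 < x" for x
      using assms(4)[OF that] set_integrable_lebesgue_eq_lborel[OF w0 w_eq] by simp
    have "(\<integral>\<^sup>+s\<in>{0<..}. ennreal (w s) \<partial>lebesgue) = (\<integral>\<^sup>+s\<in>{0<..}. ennreal (w0 s) \<partial>lborel)"
      by (rule nn_integral_lebesgue_eq_lborel) (use w_eq in \<open>auto elim!: eventually_mono\<close>)
    with assms(5) show "(\<integral>\<^sup>+s\<in>{0<..}. ennreal (w0 s) \<partial>lborel) = \<infinity>" by simp
  qed (fact w0 w0_pos)+
  \<comment> \<open>This equality holds at every point, since altering \<open>w\<close> on a null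
    set leaves its integrals unchanged.\<close>
  have prim_W: "prim w = W"
    unfolding prim_def[abs_def] W_def[abs_def] by (intro ext set_integral_lebesgue_eq_lborel w0 w_eq)
  have prim_inv_J: "prim_inv w t = J t" if "0 < t" for t
    using that by (simp add: prim_inv_def prim_W J_def)
  define U0 where "U0 t = u0 (J t) / w0 (J t)" for t
  define V0 where "V0 t = v0 (J t) / w0 (J t)" for t
  have [measurable]: "U0 \<in> borel_measurable borel" "V0 \<in> borel_measurable borel"
    unfolding U0_def[abs_def] V0_def[abs_def] by measurable
  have U0_pos: "0 < U0 t" and V0_pos: "0 < V0 t" for t
    using u0_pos v0_pos w0_pos by (simp_all add: U0_def V0_def)
  \<comment> \<open>The derivative of \<open>W\<close> is known to be \<open>w0\<close> only almost
    everywhere; the exceptional set remains null when pulled back by \<open>J\<close>.\<close>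
  have U_eq: "AE t in lborel. 0 < t \<longrightarrow> U t = U0 t"
  proof -
    have "AE x in lborel. 0 < x \<longrightarrow> u x / deriv W x = u0 x / w0 x"
      using AE_deriv_W u_eq by eventually_elim simp
    from AE_time_change[OF this] show ?thesis
      by (auto elim!: eventually_mono simp: U_def transport_def U0_def prim_inv_J prim_W)
  qed
  have V_eq: "AE t in lborel. 0 < t \<longrightarrow> V t = V0 t"
  proof -
    have "AE x in lborel. 0 < x \<longrightarrow> v x / deriv W x = v0 x / w0 x"
      using AE_deriv_W v_eq by eventually_elim simp
    from AE_time_change[OF this] show ?thesis
      by (auto elim!: eventually_mono simp: V_def transport_def V0_def prim_inv_J prim_W)
  qed
  have lnV_eq: "AE t in lborel. 0 < t \<longrightarrow> ln (1 / V t) = - ln (V0 t)"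
    using V_eq by eventually_elim (use V0_pos in \<open>simp add: ln_div\<close>)
  have lnV0: "(\<lambda>t. - ln (V0 t)) \<in> borel_measurable borel"
    by measurable
  have int_V0: "set_integrable lborel {0<..<t} (\<lambda>s. ln (V0 s))" if "0 < t" for t
  proof -
    have "set_integrable lborel {0<..<t} (\<lambda>s. - ln (V0 s))"
      using \<open>geo_mean_defined _\<close> that set_integrable_lebesgue_eq_lborel[OF lnV0 lnV_eq]
      unfolding geo_mean_defined_def by simp
    then show ?thesis by (simp add: set_integrable_def)
  qed
  have geo: "geo_mean (\<lambda>s. 1 / V s) t = exp (1 / t * (LBINT s:{0<..<t}. - ln (V0 s)))" for t
    unfolding geo_mean_def set_integral_lebesgue_eq_lborel[OF lnV0 lnV_eq] ..

  \<comment> \<open>The weight condition as a growth bound\<close>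
  define I where "I x = (\<integral>\<^sup>+t\<in>{0<..<x}. ennreal (U0 t * exp (1 / t * (LBINT s:{0<..<t}. - ln (V0 s))) powr r) \<partial>lborel)" for x
  have I: "(\<integral>\<^sup>+t\<in>{0<..<x}. ennreal (U t * geo_mean (\<lambda>s. 1 / V s) t powr (q / p)) \<partial>lebesgue) = I x" for x
    unfolding I_def geo r_def
    by (rule nn_integral_lebesgue_eq_lborel) (use U_eq in \<open>auto elim!: eventually_mono\<close>)
  \<comment> \<open>\<open>enn2real\<close> would send an infinite supremum to 0, so the finiteness
    hypothesis is what makes \<open>A\<close> the true supremum.\<close>
  define A where "A = enn2real (SUP x\<in>{0<..}. ennreal (x powr (- 1 / p)) * epowr (I x) (1 / q))"
  have A: "ennreal (x powr (- 1 / p)) * epowr (I x) (1 / q) \<le> ennreal A" if "0 < x" for x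
  proof -
    have "ennreal A = (SUP x\<in>{0<..}. ennreal (x powr (- 1 / p)) * epowr (I x) (1 / q))"
      using assms(15) unfolding I A_def by (simp add: less_top)
    moreover have "ennreal (x powr (- 1 / p)) * epowr (I x) (1 / q)
        \<le> (SUP x\<in>{0<..}. ennreal (x powr (- 1 / p)) * epowr (I x) (1 / q))"
      using that by (intro SUP_upper) simp
    ultimately show ?thesis by (simp only:)
  qed
  \<comment> \<open>Raising \<open>x powr (- 1 / p) * I x powr (1 / q) \<le> A\<close> to the power
    \<open>q\<close> turns it into \<open>I x \<le> A powr q * x powr (q / p)\<close>.\<close>
  define K where "K = A powr q"
  have I_le: "I x \<le> ennreal (K * x powr r)" if "0 < x" for x
  proof (cases "I x")
    case (real i)
    have "x powr (- 1 / p) * i powr (1 / q) \<le> A"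
      using A[OF that] real by (simp add: epowr_ennreal ennreal_mult'[symmetric] A_def)
    then have "(x powr (- 1 / p) * i powr (1 / q)) powr q \<le> K"
      unfolding K_def using \<open>0 < q\<close> by (intro powr_mono2) auto
    also have "(x powr (- 1 / p) * i powr (1 / q)) powr q = i / x powr r"
      using \<open>0 \<le> i\<close> \<open>0 < q\<close> that by (simp add: powr_mult powr_divide powr_powr r_def powr_minus_divide)
    finally have "i \<le> K * x powr r"
      using that by (simp add: field_simps)
    then show ?thesis using real by (simp add: ennreal_leI)
  next
    \<comment> \<open>An infinite \<open>I x\<close> would make the left-hand side of
      \<open>A\<close> infinite, as \<open>x powr (- 1 / p)\<close> is positive.\<close>
    case top
    then show ?thesis using A[OF that] that by (simp add: epowr_def ennreal_mult_top top_unique)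
  qed
  define c where "c = (1 + r) * K * exp r"
  have "0 \<le> c"
    using assms(1) \<open>0 < q\<close> by (simp add: c_def r_def K_def)
  define \<phi> where "\<phi> = the_inv_into {0<..} g"
  define S where "S = g ` {0<..}"
  have inj: "inj_on g {0<..}"
    using assms(8) unfolding monotone_on_def inj_on_def by (metis linorder_neqE less_irrefl)
  have \<phi>_g: "\<phi> (g x) = x" if "0 < x" for x
    using that inj by (simp add: \<phi>_def the_inv_into_f_f)
  have \<Phi>: "class_Phi S \<phi>"
    using assms(9) by (simp add: S_def \<phi>_def)
  then obtain a b :: ereal where ab: "0 \<le> a" "S = einterval a b"
    unfolding class_Phi_def by blast
  have \<phi>_pos: "0 < \<phi> y" if "y \<in> S" for y
    using \<Phi> that unfolding class_Phi_def by blast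
  show ?thesis
  \<comment> \<open>Only \<open>0 \<le> c\<close> has been established, while the final constant
    must be positive; hence \<open>c + 1\<close>.\<close>
  proof (intro exI[of _ "(c + 1) powr (1 / q)"] conjI allI impI)
    show "0 < (c + 1) powr (1 / q)"
      using \<open>0 \<le> c\<close> by simp

    \<comment> \<open>The inequality for one function \<open>f\<close>\<close>
    fix f :: "real \<Rightarrow> real"
    assume f: "set_borel_measurable lebesgue {0<..} f" "\<forall>x>0. 0 < f x" "gen_mean_defined g w f"
    obtain f0 where f0 [measurable]: "f0 \<in> borel_measurable borel" and f0_pos: "\<And>x. 0 < f0 x"
        and f_eq: "AE x in lborel. 0 < x \<longrightarrow> f x = f0 x"
      using positive_borel_representative[of f] f by blast
    define F where "F t = f0 (J t)" for t
    have [measurable]: "F \<in> borel_measurable borel"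
      unfolding F_def[abs_def] by measurable
    have F_pos: "0 < F t" for t
      using f0_pos by (simp add: F_def)
    have gf0 [measurable]: "(\<lambda>x. g (f0 x)) \<in> borel_measurable borel"
      using f0_pos
      by (intro measurable_compose[OF measurable_restrict_space2 borel_measurable_continuous_on_restrict[OF assms(7)]]) auto
    have wgf: "(\<lambda>x. w0 x * g (f0 x)) \<in> borel_measurable borel"
      by measurable
    have wgf_eq: "AE x in lborel. 0 < x \<longrightarrow> w x * g (f x) = w0 x * g (f0 x)"
      using w_eq f_eq by eventually_elim simp
    have int_gF: "set_integrable lborel {0<..<t} (\<lambda>s. g (F s))" if "0 < t" for t
      using f(3) set_integrable_lebesgue_eq_lborel[OF wgf wgf_eq]
        set_integral_time_change(1)[OF gf0 J_pos[OF that]] J_pos[OF that] W_J[OF that]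
      unfolding gen_mean_defined_def F_def by simp
    define m where "m t = 1 / t * (LBINT s:{0<..<t}. g (F s))" for t
    have gen_mean: "gen_mean g w f x = \<phi> (m (W x))" if "0 < x" for x
      unfolding gen_mean_def \<phi>_def m_def prim_W F_def
        set_integral_lebesgue_eq_lborel[OF wgf wgf_eq] set_integral_time_change(2)[OF gf0 that] ..
    have gF_in: "g (F s) \<in> S" for s
      using F_pos by (simp add: S_def)
    have m_in: "m t \<in> S" if "0 < t" for t
      using mean_in_einterval[OF ab(1) that int_gF[OF that]] gF_in unfolding m_def ab(2) by blast
    \<comment> \<open>The supporting line of \<open>ln (\<phi> y)\<close> at the mean
      \<open>m t\<close>, evaluated at \<open>g (F s)\<close>: its linear term integrates to 0. It
      serves twice, as the integrable minorant of \<open>ln F\<close> and as the source of Jensen's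
      inequality.\<close>
    have tangent: "\<exists>l. set_integrable lborel {0<..<t} l \<and> (LBINT s:{0<..<t}. l s) = t * ln (\<phi> (m t)) \<and>
        (\<forall>s. l s \<le> ln (F s))" if "0 < t" for t
    proof -
      obtain \<beta> where \<beta>: "\<And>y. y \<in> S \<Longrightarrow> ln (\<phi> (m t)) + \<beta> * (y - m t) \<le> ln (\<phi> y)"
        using class_Phi_tangent[OF \<Phi> m_in[OF \<open>0 < t\<close>]] by blast
      define k where "k = ln (\<phi> (m t)) - \<beta> * m t"
      have k: "set_integrable lborel {0<..<t} (\<lambda>s. k)" "(LBINT s:{0<..<t}. k) = k * t"
        using \<open>0 < t\<close> by (auto simp: set_integrable_def set_lebesgue_integral_def)
      have \<beta>g: "set_integrable lborel {0<..<t} (\<lambda>s. \<beta> * g (F s))"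
        using int_gF[OF that] by simp
      have "set_integrable lborel {0<..<t} (\<lambda>s. k + \<beta> * g (F s))"
        by (rule set_integral_add(1)[OF k(1) \<beta>g])
      moreover have "(LBINT s:{0<..<t}. k + \<beta> * g (F s)) = t * ln (\<phi> (m t))"
        unfolding set_integral_add(2)[OF k(1) \<beta>g] k(2) using \<open>0 < t\<close> by (simp add: k_def m_def field_simps)
      moreover have "k + \<beta> * g (F s) \<le> ln (F s)" for s
        using \<beta>[OF gF_in[of s]] \<phi>_g[OF F_pos[of s]] by (simp add: k_def algebra_simps)
      ultimately show ?thesis by blast
    qed
    define R where "R = (\<integral>\<^sup>+x\<in>{0<..}. ennreal (v x * f x powr p) \<partial>lebesgue)"
    have R: "R = (\<integral>\<^sup>+t\<in>{0<..}. ennreal (V0 t * F t powr p) \<partial>lborel)"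
    proof -
      have "R = (\<integral>\<^sup>+x\<in>{0<..}. ennreal (w0 x) * ennreal (v0 x / w0 x * f0 x powr p) \<partial>lborel)"
        unfolding R_def
      proof (rule nn_integral_lebesgue_eq_lborel)
        show "AE x in lborel. x \<in> {0<..} \<longrightarrow> ennreal (v x * f x powr p) = ennreal (w0 x) * ennreal (v0 x / w0 x * f0 x powr p)"
          using v_eq f_eq
        proof eventually_elim
          case (elim x)
          then show ?case
            using w0_pos[of x] v0_pos[of x] by (simp add: ennreal_mult'[symmetric])
        qed
      qed
      also have "\<dots> = (\<integral>\<^sup>+t\<in>{0<..}. ennreal (V0 t * F t powr p) \<partial>lborel)"
        unfolding V0_def F_def by (rule nn_integral_time_change) measurable
      finally show ?thesis .
    qed
    show "epowr (\<integral>\<^sup>+x\<in>{0<..}. ennreal (u x * gen_mean g w f x powr q) \<partial>lebesgue) (1 / q)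
        \<le> ennreal ((c + 1) powr (1 / q)) * epowr (\<integral>\<^sup>+x\<in>{0<..}. ennreal (v x * f x powr p) \<partial>lebesgue) (1 / p)"
      unfolding R_def[symmetric]
    proof (cases R)
      \<comment> \<open>With a positive constant the right-hand side is infinite here. Only in the
        other case is \<open>ln F\<close> shown to be integrable, so Jensen's inequality is
        postponed until then.\<close>
      case top
      then show "epowr (\<integral>\<^sup>+x\<in>{0<..}. ennreal (u x * gen_mean g w f x powr q) \<partial>lebesgue) (1 / q)
          \<le> ennreal ((c + 1) powr (1 / q)) * epowr R (1 / p)"
        using \<open>0 \<le> c\<close> by (simp add: epowr_def ennreal_mult_top)
    next
      case (real H)
      have lower: "\<exists>l. set_integrable lborel {0<..<t} l \<and> (\<forall>s. 0 < s \<longrightarrow> l s \<le> ln (F s))" if "0 < t" for t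
        using tangent[OF that] by blast
      have K': "(\<integral>\<^sup>+t\<in>{0<..<x}. ennreal (U0 t * exp (1 / t * (LBINT s:{0<..<t}. - ln (V0 s))) powr (q / p)) \<partial>lborel)
          \<le> ennreal (K * x powr (q / p))" if "0 < x" for x
        using I_le[OF that] unfolding I_def r_def .
      have H: "(\<integral>\<^sup>+s\<in>{0<..}. ennreal (V0 s * F s powr p) \<partial>lborel) = ennreal H"
        using R real by simp
      have "0 \<le> K" by (simp add: K_def)
      note t_space = \<open>F \<in> _\<close> \<open>U0 \<in> _\<close> \<open>V0 \<in> _\<close> F_pos U0_pos V0_pos assms(1,2) \<open>0 \<le> K\<close> int_V0 K' H lower
      have int_lnF: "set_integrable lborel {0<..<t} (\<lambda>s. ln (F s))" if "0 < t" for t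
        by (rule set_integrable_ln_of_lower_bound[OF t_space that])
      define M where "M t = exp (1 / t * (LBINT s:{0<..<t}. ln (F s)))" for t
      have [measurable]: "M \<in> borel_measurable borel"
        unfolding M_def[abs_def] by measurable
      have jensen: "\<phi> (m t) \<le> M t" if "0 < t" for t
      proof -
        obtain l where l: "set_integrable lborel {0<..<t} l" "(LBINT s:{0<..<t}. l s) = t * ln (\<phi> (m t))"
            "\<And>s. l s \<le> ln (F s)"
          using tangent[OF \<open>0 < t\<close>] by blast
        have "t * ln (\<phi> (m t)) \<le> (LBINT s:{0<..<t}. ln (F s))"
          unfolding l(2)[symmetric] by (intro set_integral_mono l int_lnF that)
        then have "ln (\<phi> (m t)) \<le> 1 / t * (LBINT s:{0<..<t}. ln (F s))"
          using that by (simp add: field_simps)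
        then show ?thesis
          unfolding M_def using \<phi>_pos[OF m_in[OF that]] by (simp add: ln_ge_iff exp_ln_iff flip: ln_le_cancel_iff)
      qed
      have "(\<integral>\<^sup>+x\<in>{0<..}. ennreal (u x * gen_mean g w f x powr q) \<partial>lebesgue)
          = (\<integral>\<^sup>+x\<in>{0<..}. ennreal (u0 x * \<phi> (m (W x)) powr q) \<partial>lborel)"
        by (rule nn_integral_lebesgue_eq_lborel) (use u_eq gen_mean in \<open>auto elim!: eventually_mono\<close>)
      \<comment> \<open>Besides applying Jensen's inequality, this multiplies and divides by
        \<open>w0 x\<close>, giving the product form needed for the change of variables.\<close>
      also have "\<dots> \<le> (\<integral>\<^sup>+x\<in>{0<..}. ennreal (w0 x) * ennreal (u0 x / w0 x * M (W x) powr q) \<partial>lborel)"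
      proof (intro nn_integral_mono)
        fix x
        show "ennreal (u0 x * \<phi> (m (W x)) powr q) * indicator {0<..} x
            \<le> ennreal (w0 x) * ennreal (u0 x / w0 x * M (W x) powr q) * indicator {0<..} x"
        proof (cases "0 < x")
          case True
          have "\<phi> (m (W x)) powr q \<le> M (W x) powr q"
            using \<phi>_pos[OF m_in[OF W_pos[OF True]]] jensen[OF W_pos[OF True]] \<open>0 < q\<close>
            by (intro powr_mono2) auto
          then show ?thesis
            using u0_pos[of x] w0_pos[of x] True
            by (simp add: ennreal_mult'[symmetric] ennreal_leI)
        qed simp
      qed
      also have "\<dots> = (\<integral>\<^sup>+t\<in>{0<..}. ennreal (u0 (J t) / w0 (J t) * M (W (J t)) powr q) \<partial>lborel)"
        by (rule nn_integral_time_change) measurable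
      also have "\<dots> = (\<integral>\<^sup>+t\<in>{0<..}. ennreal (U0 t * M t powr q) \<partial>lborel)"
        by (intro nn_integral_cong) (simp add: U0_def W_J split: split_indicator)
      also have "\<dots> \<le> ennreal ((1 + q / p) * K * exp (q / p) * H powr (q / p))"
        unfolding M_def by (rule exp_mean_ln_inequality[OF t_space])
      also have "\<dots> = ennreal (c * H powr r)"
        by (simp add: c_def r_def)
      finally have "epowr (\<integral>\<^sup>+x\<in>{0<..}. ennreal (u x * gen_mean g w f x powr q) \<partial>lebesgue) (1 / q)
          \<le> epowr (ennreal (c * H powr r)) (1 / q)"
        using \<open>0 < q\<close> by (intro epowr_mono) auto
      also have "\<dots> = ennreal (c powr (1 / q) * H powr (1 / p))"
        using \<open>0 \<le> c\<close> \<open>0 < q\<close> assms(1) by (simp add: epowr_ennreal powr_mult powr_powr r_def)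
      also have "\<dots> \<le> ennreal ((c + 1) powr (1 / q) * H powr (1 / p))"
        using \<open>0 \<le> c\<close> \<open>0 < q\<close> by (intro ennreal_leI mult_right_mono powr_mono2) auto
      also have "\<dots> = ennreal ((c + 1) powr (1 / q)) * epowr R (1 / p)"
        using real by (simp add: epowr_ennreal ennreal_mult')
      finally show "epowr (\<integral>\<^sup>+x\<in>{0<..}. ennreal (u x * gen_mean g w f x powr q) \<partial>lebesgue) (1 / q)
          \<le> ennreal ((c + 1) powr (1 / q)) * epowr R (1 / p)" .
    qed
  qed
qed

end
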